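(* Each adjoint pair $(F,G):\mathcal{A}\longrightarrow\mathcal{B}$ between abelian categories induces a Galois connection $(\varphi,\psi):Pr(\mathcal{A})\longrightarrow Pr(\mathcal{B})$.
   Context: Convention: all categories are locally small (not necessarily small), where locally small means that the class of subobjects of any given object is a set. An adjoint pair $(F,G):\mathcal{A}\to\mathcal{B}$ consists of functors $F:\mathcal{A}\to\mathcal{B}$ and $G:\mathcal{B}\to\mathcal{A}$ with $F$ left adjoint to $G$. For an abelian category $\mathcal{A}$, $\mathrm{Fun}(\mathcal{A},\mathcal{A})$ is the (extended) abelian category of covariant functors $\mathcal{A}\to\mathcal{A}$ and natural transformations; "extended" means that the natural transformations between two functors need not form a set. A preradical of $\mathcal{A}$ is a subobject of the identity functor $1_{\mathcal{A}}$ in $\mathrm{Fun}(\mathcal{A},\mathcal{A})$, i.e. the equivalence class of a monomorphism $\tau:T\hookrightarrow 1_{\mathcal{A}}$, where two such monomorphisms are equivalent if each factors through the other. $Pr(\mathcal{A})$ denotes the collection (not necessarily a set) of all preradicals of $\mathcal{A}$, partially ordered by: $\tau\leq\sigma$ if and only if $\tau$ factors through $\sigma$. $Pr(\mathcal{B})$ is defined and ordered in the same way for $\mathcal{B}$. A Galois connection $(\varphi,\psi):P\to Q$ between partially ordered collections $(P,\leq)$ and $(Q,\preceq)$ consists of two assignments $\varphi:P\to Q$ and $\psi:Q\to P$ such that for all $p\in P$ and $q\in Q$: $p\leq\psi(q)\iff\varphi(p)\preceq q$. *)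

theory Defs
  imports "HOL-Algebra.Group" "HOL-Algebra.Galois_Connection" "HOL-Library.FuncSet"
begin

section \<open>Categories\<close>

text \<open>
  The objects and the arrows of a category form sets over arbitrary types, and every arrow knows
  its domain and codomain. No size restriction is needed: in particular the
  subobjects of an object always form a set. Composition is written in the order of function
  composition and is meaningful on composable arrows only.
\<close>

record ('o, 'm) category =
  Obj :: "'o set"
  Arr :: "'m set"
  Dom :: "'m \<Rightarrow> 'o"
  Cod :: "'m \<Rightarrow> 'o"
  Ide :: "'o \<Rightarrow> 'm"
  Cmp :: "'m \<Rightarrow> 'm \<Rightarrow> 'm"  (infixr \<open>\<cdot>\<index>\<close> 70)

definition Hom :: "('o, 'm) category \<Rightarrow> 'o \<Rightarrow> 'o \<Rightarrow> 'm set" where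
  "Hom C x y = {f \<in> Arr C. Dom C f = x \<and> Cod C f = y}"

locale category =
  fixes C :: "('o, 'm) category" (structure)
  assumes dom_obj: "f \<in> Arr C \<Longrightarrow> Dom C f \<in> Obj C"
    and cod_obj: "f \<in> Arr C \<Longrightarrow> Cod C f \<in> Obj C"
    and ide_hom: "x \<in> Obj C \<Longrightarrow> Ide C x \<in> Hom C x x"
    and cmp_hom: "f \<in> Hom C x y \<Longrightarrow> g \<in> Hom C y z \<Longrightarrow> g \<cdot> f \<in> Hom C x z"
    and cmp_ide: "f \<in> Hom C x y \<Longrightarrow> f \<cdot> Ide C x = f"
    and ide_cmp: "f \<in> Hom C x y \<Longrightarrow> Ide C y \<cdot> f = f"
    and cmp_assoc: "f \<in> Hom C w x \<Longrightarrow> g \<in> Hom C x y \<Longrightarrow> h \<in> Hom C y z \<Longrightarrow>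
          (h \<cdot> g) \<cdot> f = h \<cdot> (g \<cdot> f)"

definition is_mono :: "('o, 'm) category \<Rightarrow> 'm \<Rightarrow> bool" where
  "is_mono C m \<longleftrightarrow> m \<in> Arr C \<and>
    (\<forall>x. \<forall>f \<in> Hom C x (Dom C m). \<forall>g \<in> Hom C x (Dom C m).
       m \<cdot>\<^bsub>C\<^esub> f = m \<cdot>\<^bsub>C\<^esub> g \<longrightarrow> f = g)"

definition is_epi :: "('o, 'm) category \<Rightarrow> 'm \<Rightarrow> bool" where
  "is_epi C e \<longleftrightarrow> e \<in> Arr C \<and>
    (\<forall>x. \<forall>f \<in> Hom C (Cod C e) x. \<forall>g \<in> Hom C (Cod C e) x.
       f \<cdot>\<^bsub>C\<^esub> e = g \<cdot>\<^bsub>C\<^esub> e \<longrightarrow> f = g)"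

definition is_zero_obj :: "('o, 'm) category \<Rightarrow> 'o \<Rightarrow> bool" where
  "is_zero_obj C z \<longleftrightarrow> z \<in> Obj C \<and>
    (\<forall>x \<in> Obj C. (\<exists>!f. f \<in> Hom C x z) \<and> (\<exists>!f. f \<in> Hom C z x))"

definition is_zero_arr :: "('o, 'm) category \<Rightarrow> 'm \<Rightarrow> bool" where
  "is_zero_arr C f \<longleftrightarrow> f \<in> Arr C \<and>
    (\<exists>z g h. is_zero_obj C z \<and> g \<in> Hom C (Dom C f) z \<and> h \<in> Hom C z (Cod C f) \<and>
       f = h \<cdot>\<^bsub>C\<^esub> g)"

definition is_kernel :: "('o, 'm) category \<Rightarrow> 'm \<Rightarrow> 'm \<Rightarrow> bool" where
  "is_kernel C k f \<longleftrightarrow> f \<in> Arr C \<and> k \<in> Arr C \<and> Cod C k = Dom C f \<and>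
    is_zero_arr C (f \<cdot>\<^bsub>C\<^esub> k) \<and>
    (\<forall>h \<in> Arr C. Cod C h = Dom C f \<and> is_zero_arr C (f \<cdot>\<^bsub>C\<^esub> h) \<longrightarrow>
       (\<exists>!u. u \<in> Hom C (Dom C h) (Dom C k) \<and> k \<cdot>\<^bsub>C\<^esub> u = h))"

definition is_cokernel :: "('o, 'm) category \<Rightarrow> 'm \<Rightarrow> 'm \<Rightarrow> bool" where
  "is_cokernel C c f \<longleftrightarrow> f \<in> Arr C \<and> c \<in> Arr C \<and> Dom C c = Cod C f \<and>
    is_zero_arr C (c \<cdot>\<^bsub>C\<^esub> f) \<and>
    (\<forall>h \<in> Arr C. Dom C h = Cod C f \<and> is_zero_arr C (h \<cdot>\<^bsub>C\<^esub> f) \<longrightarrow>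
       (\<exists>!u. u \<in> Hom C (Cod C c) (Cod C h) \<and> u \<cdot>\<^bsub>C\<^esub> c = h))"

text \<open>\<open>f \<cdot> p = g \<cdot> q\<close> is a pullback square; \<open>p\<close> is the pullback of \<open>g\<close> along \<open>f\<close>.\<close>

definition is_pullback :: "('o, 'm) category \<Rightarrow> 'm \<Rightarrow> 'm \<Rightarrow> 'm \<Rightarrow> 'm \<Rightarrow> bool" where
  "is_pullback C p q f g \<longleftrightarrow> f \<in> Arr C \<and> g \<in> Arr C \<and> p \<in> Arr C \<and> q \<in> Arr C \<and>
    Cod C f = Cod C g \<and> Dom C p = Dom C q \<and> Cod C p = Dom C f \<and> Cod C q = Dom C g \<and>
    f \<cdot>\<^bsub>C\<^esub> p = g \<cdot>\<^bsub>C\<^esub> q \<and>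
    (\<forall>a b w. a \<in> Hom C w (Dom C f) \<and> b \<in> Hom C w (Dom C g) \<and> f \<cdot>\<^bsub>C\<^esub> a = g \<cdot>\<^bsub>C\<^esub> b \<longrightarrow>
       (\<exists>!u. u \<in> Hom C w (Dom C p) \<and> p \<cdot>\<^bsub>C\<^esub> u = a \<and> q \<cdot>\<^bsub>C\<^esub> u = b))"


section \<open>Abelian categories\<close>

definition preadditive :: "('o, 'm) category \<Rightarrow> ('m \<Rightarrow> 'm \<Rightarrow> 'm) \<Rightarrow> bool" where
  "preadditive C add \<longleftrightarrow>
    (\<forall>x \<in> Obj C. \<forall>y \<in> Obj C. \<exists>z. comm_group \<lparr>carrier = Hom C x y, mult = add, one = z\<rparr>) \<and>
    (\<forall>x y z. \<forall>f \<in> Hom C x y. \<forall>f' \<in> Hom C x y. \<forall>g \<in> Hom C y z. \<forall>g' \<in> Hom C y z.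
       g \<cdot>\<^bsub>C\<^esub> add f f' = add (g \<cdot>\<^bsub>C\<^esub> f) (g \<cdot>\<^bsub>C\<^esub> f') \<and>
       add g g' \<cdot>\<^bsub>C\<^esub> f = add (g \<cdot>\<^bsub>C\<^esub> f) (g' \<cdot>\<^bsub>C\<^esub> f))"

definition has_biproducts :: "('o, 'm) category \<Rightarrow> ('m \<Rightarrow> 'm \<Rightarrow> 'm) \<Rightarrow> bool" where
  "has_biproducts C add \<longleftrightarrow>
    (\<forall>x \<in> Obj C. \<forall>y \<in> Obj C. \<exists>s \<in> Obj C.
       \<exists>p \<in> Hom C s x. \<exists>q \<in> Hom C s y. \<exists>i \<in> Hom C x s. \<exists>j \<in> Hom C y s.
         p \<cdot>\<^bsub>C\<^esub> i = Ide C x \<and> q \<cdot>\<^bsub>C\<^esub> j = Ide C y \<and>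
         add (i \<cdot>\<^bsub>C\<^esub> p) (j \<cdot>\<^bsub>C\<^esub> q) = Ide C s)"

text \<open>
  The addition of an abelian category is determined by its composition, so being abelian is a
  property of the category and functors are not required to be additive.
\<close>

locale abelian_category = category C for C :: "('o, 'm) category" (structure) +
  assumes additive: "\<exists>add. preadditive C add \<and> has_biproducts C add"
    and zero_object: "\<exists>z. is_zero_obj C z"
    and kernels: "f \<in> Arr C \<Longrightarrow> \<exists>k. is_kernel C k f"
    and cokernels: "f \<in> Arr C \<Longrightarrow> \<exists>c. is_cokernel C c f"
    and mono_normal: "is_mono C m \<Longrightarrow> \<exists>f. is_kernel C m f"
    and epi_normal: "is_epi C e \<Longrightarrow> \<exists>f. is_cokernel C e f"


section \<open>Subobjects\<close>

definition factors_through :: "('o, 'm) category \<Rightarrow> 'm \<Rightarrow> 'm \<Rightarrow> bool" where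
  "factors_through C f g \<longleftrightarrow> (\<exists>u \<in> Hom C (Dom C f) (Dom C g). f = g \<cdot>\<^bsub>C\<^esub> u)"

definition monos_into :: "('o, 'm) category \<Rightarrow> 'o \<Rightarrow> 'm set" where
  "monos_into C x = {m. is_mono C m \<and> Cod C m = x}"

definition subobj_rel :: "('o, 'm) category \<Rightarrow> 'o \<Rightarrow> ('m \<times> 'm) set" where
  "subobj_rel C x = {(m, n). m \<in> monos_into C x \<and> n \<in> monos_into C x \<and>
     factors_through C m n \<and> factors_through C n m}"

definition Sub :: "('o, 'm) category \<Rightarrow> 'o \<Rightarrow> 'm set gorder" where
  "Sub C x = \<lparr>carrier = monos_into C x // subobj_rel C x, eq = (=),
     le = (\<lambda>P Q. \<exists>m \<in> P. \<exists>n \<in> Q. factors_through C m n)\<rparr>"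

text \<open>
  The image of an arrow is the kernel of its cokernel. As kernels and cokernels are determined up
  to isomorphism, the set of all choices is a full equivalence class of monomorphisms, that is, a
  subobject. The same applies to the inverse image of a subobject \<open>P\<close>, the class of all pullbacks
  of representatives of \<open>P\<close>.
\<close>

definition image_of :: "('o, 'm) category \<Rightarrow> 'm \<Rightarrow> 'm set" where
  "image_of C f = {m. \<exists>c. is_cokernel C c f \<and> is_kernel C m c}"

definition pullback_of :: "('o, 'm) category \<Rightarrow> 'm \<Rightarrow> 'm \<Rightarrow> 'm set" where
  "pullback_of C f g = {p. \<exists>q. is_pullback C p q f g}"


section \<open>Functors and natural transformations\<close>

text \<open>
  The maps of a functor and the components of a natural transformation are extensional (that is,
  \<open>undefined\<close> off the source category), so that HOL equality is equality of functors and of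
  natural transformations.
\<close>

record ('o, 'm, 'p, 'n) fnctr =
  fobj :: "'o \<Rightarrow> 'p"
  farr :: "'m \<Rightarrow> 'n"

definition is_functor ::
  "('o, 'm) category \<Rightarrow> ('p, 'n) category \<Rightarrow> ('o, 'm, 'p, 'n) fnctr \<Rightarrow> bool" where
  "is_functor C D F \<longleftrightarrow>
     fobj F \<in> Obj C \<rightarrow>\<^sub>E Obj D \<and> farr F \<in> Arr C \<rightarrow>\<^sub>E Arr D \<and>
     (\<forall>x y. \<forall>f \<in> Hom C x y. farr F f \<in> Hom D (fobj F x) (fobj F y)) \<and>
     (\<forall>x \<in> Obj C. farr F (Ide C x) = Ide D (fobj F x)) \<and>
     (\<forall>x y z. \<forall>f \<in> Hom C x y. \<forall>g \<in> Hom C y z.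
        farr F (g \<cdot>\<^bsub>C\<^esub> f) = farr F g \<cdot>\<^bsub>D\<^esub> farr F f)"

definition id_functor :: "('o, 'm) category \<Rightarrow> ('o, 'm, 'o, 'm) fnctr" where
  "id_functor C = \<lparr>fobj = (\<lambda>x \<in> Obj C. x), farr = (\<lambda>f \<in> Arr C. f)\<rparr>"

text \<open>\<open>comp_functor C G F\<close> is the composite of \<open>F\<close>, whose source is \<open>C\<close>, followed by \<open>G\<close>.\<close>

definition comp_functor ::
  "('o, 'm) category \<Rightarrow> ('p, 'n, 'q, 'r) fnctr \<Rightarrow> ('o, 'm, 'p, 'n) fnctr
     \<Rightarrow> ('o, 'm, 'q, 'r) fnctr" where
  "comp_functor C G F =
     \<lparr>fobj = (\<lambda>x \<in> Obj C. fobj G (fobj F x)), farr = (\<lambda>f \<in> Arr C. farr G (farr F f))\<rparr>"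

record ('o, 'm, 'p, 'n) nat_tr =
  src :: "('o, 'm, 'p, 'n) fnctr"
  trg :: "('o, 'm, 'p, 'n) fnctr"
  cmpt :: "'o \<Rightarrow> 'n"

definition is_nat_tr ::
  "('o, 'm) category \<Rightarrow> ('p, 'n) category \<Rightarrow> ('o, 'm, 'p, 'n) nat_tr \<Rightarrow> bool" where
  "is_nat_tr C D \<tau> \<longleftrightarrow>
     is_functor C D (src \<tau>) \<and> is_functor C D (trg \<tau>) \<and> cmpt \<tau> \<in> extensional (Obj C) \<and>
     (\<forall>x \<in> Obj C. cmpt \<tau> x \<in> Hom D (fobj (src \<tau>) x) (fobj (trg \<tau>) x)) \<and>
     (\<forall>x y. \<forall>f \<in> Hom C x y.
        cmpt \<tau> y \<cdot>\<^bsub>D\<^esub> farr (src \<tau>) f = farr (trg \<tau>) f \<cdot>\<^bsub>D\<^esub> cmpt \<tau> x)"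

definition Fun ::
  "('o, 'm) category \<Rightarrow> ('p, 'n) category
     \<Rightarrow> (('o, 'm, 'p, 'n) fnctr, ('o, 'm, 'p, 'n) nat_tr) category" where
  "Fun C D =
     \<lparr>Obj = {F. is_functor C D F},
      Arr = {\<tau>. is_nat_tr C D \<tau>},
      Dom = src,
      Cod = trg,
      Ide = (\<lambda>F. \<lparr>src = F, trg = F, cmpt = (\<lambda>x \<in> Obj C. Ide D (fobj F x))\<rparr>),
      Cmp = (\<lambda>\<sigma> \<tau>. \<lparr>src = src \<tau>, trg = trg \<sigma>,
                     cmpt = (\<lambda>x \<in> Obj C. cmpt \<sigma> x \<cdot>\<^bsub>D\<^esub> cmpt \<tau> x)\<rparr>)\<rparr>"

text \<open>
  \<open>whisker B H \<tau> K\<close> is the natural transformation \<open>H \<tau> K : H S K \<Rightarrow> H T K\<close> with components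
  \<open>H (\<tau> (K y))\<close>, for \<open>\<tau> : S \<Rightarrow> T\<close> and \<open>K\<close> with source \<open>B\<close>.
\<close>

definition whisker ::
  "('o, 'm) category \<Rightarrow> ('r, 's, 't, 'u) fnctr \<Rightarrow> ('p, 'n, 'r, 's) nat_tr
     \<Rightarrow> ('o, 'm, 'p, 'n) fnctr \<Rightarrow> ('o, 'm, 't, 'u) nat_tr" where
  "whisker B H \<tau> K =
     \<lparr>src = comp_functor B H (comp_functor B (src \<tau>) K),
      trg = comp_functor B H (comp_functor B (trg \<tau>) K),
      cmpt = (\<lambda>y \<in> Obj B. farr H (cmpt \<tau> (fobj K y)))\<rparr>"

definition adjoint_pair ::
  "('a, 'm) category \<Rightarrow> ('b, 'n) category \<Rightarrow> ('a, 'm, 'b, 'n) fnctr \<Rightarrow> ('b, 'n, 'a, 'm) fnctr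
     \<Rightarrow> ('a, 'm, 'a, 'm) nat_tr \<Rightarrow> ('b, 'n, 'b, 'n) nat_tr \<Rightarrow> bool" where
  "adjoint_pair A B F G \<eta> \<epsilon> \<longleftrightarrow>
     is_functor A B F \<and> is_functor B A G \<and>
     \<eta> \<in> Hom (Fun A A) (id_functor A) (comp_functor A G F) \<and>
     \<epsilon> \<in> Hom (Fun B B) (comp_functor B F G) (id_functor B) \<and>
     (\<forall>x \<in> Obj A. cmpt \<epsilon> (fobj F x) \<cdot>\<^bsub>B\<^esub> farr F (cmpt \<eta> x) = Ide B (fobj F x)) \<and>
     (\<forall>y \<in> Obj B. farr G (cmpt \<epsilon> y) \<cdot>\<^bsub>A\<^esub> cmpt \<eta> (fobj G y) = Ide A (fobj G y))"


section \<open>Preradicals\<close>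

definition Pr :: "('o, 'm) category \<Rightarrow> ('o, 'm, 'o, 'm) nat_tr set gorder" where
  "Pr C = Sub (Fun C C) (id_functor C)"

text \<open>
  An adjoint pair \<open>(F, G)\<close> with unit \<open>\<eta>\<close> and counit \<open>\<epsilon>\<close> sends the preradical represented by
  \<open>\<tau> : T \<Rightarrow> 1\<close> to the image of \<open>\<epsilon> \<cdot> F \<tau> G : F T G \<Rightarrow> F G \<Rightarrow> 1\<close>, and the preradical represented by
  \<open>\<sigma> : S \<Rightarrow> 1\<close> to the pullback of \<open>G \<sigma> F : G S F \<Rightarrow> G F\<close> along \<open>\<eta> : 1 \<Rightarrow> G F\<close>. The unions range over
  the representatives of a preradical, all of which give the same class.
\<close>

definition induced_lower ::
  "('b, 'n) category \<Rightarrow> ('a, 'm, 'b, 'n) fnctr \<Rightarrow> ('b, 'n, 'a, 'm) fnctr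
     \<Rightarrow> ('b, 'n, 'b, 'n) nat_tr \<Rightarrow> ('a, 'm, 'a, 'm) nat_tr set \<Rightarrow> ('b, 'n, 'b, 'n) nat_tr set" where
  "induced_lower B F G \<epsilon> P =
     (\<Union>\<tau> \<in> P. image_of (Fun B B) (\<epsilon> \<cdot>\<^bsub>Fun B B\<^esub> whisker B F \<tau> G))"

definition induced_upper ::
  "('a, 'm) category \<Rightarrow> ('a, 'm, 'b, 'n) fnctr \<Rightarrow> ('b, 'n, 'a, 'm) fnctr
     \<Rightarrow> ('a, 'm, 'a, 'm) nat_tr \<Rightarrow> ('b, 'n, 'b, 'n) nat_tr set \<Rightarrow> ('a, 'm, 'a, 'm) nat_tr set" where
  "induced_upper A F G \<eta> Q =
     (\<Union>\<sigma> \<in> Q. pullback_of (Fun A A) \<eta> (whisker A G \<sigma> F))"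

end

theory Submission
  imports Defs
begin

text \<open>
  A functor category into an abelian category has kernels and cokernels, computed componentwise, and
  all its monomorphisms are normal. Hence images and pullbacks of monomorphisms exist in it, and as
  subobjects they are determined by factorization properties: the image of \<open>f\<close> lies below \<open>n\<close> iff
  \<open>f\<close> factors through \<open>n\<close>, and \<open>h\<close> factors through the pullback of \<open>g\<close> along \<open>f\<close> iff \<open>f \<cdot> h\<close>
  factors through \<open>g\<close>. The Galois property thus says that \<open>\<epsilon> \<cdot> F \<tau> G\<close> factors through \<open>\<sigma>\<close> iff
  \<open>\<eta> \<cdot> \<tau>\<close> factors through \<open>G \<sigma> F\<close>. Both can be tested componentwise, and factorizations
  \<open>u\<close> at \<open>F x\<close> and \<open>v\<close> at \<open>G y\<close> are converted into one another by transposition, naturality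
  of the preradicals at \<open>\<eta>\<close> and \<open>\<epsilon>\<close>, and the triangle identities. The same equivalence shows that
  the image and the pullback do not depend on the chosen representatives.
\<close>

section \<open>Subobjects and zero arrows\<close>

text \<open>The delicate point is that a monomorphism \<open>n\<close> of \<open>Fun C D\<close> has
  monomorphic components: \<open>is_mono\<close> tests \<open>n\<close> against natural
  transformations only, and an arrow into one component need not extend to a natural transformation.
  The way round is to assemble a kernel of \<open>n\<close> from kernels of the components. It is
  annihilated by \<open>n\<close>, hence zero, and in an abelian category an arrow with zero kernel
  is mono; this last fact is the one place where the addition of arrows enters. Normality in
  \<open>Fun C D\<close> follows, since each component of a monomorphism is the kernel of its
  cokernel. The two induced maps have different shapes because a right adjoint preserves
  monomorphisms and a left adjoint need not: \<open>G \<sigma> F\<close> can be pulled back along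
  \<open>\<eta>\<close> to a subobject, whereas \<open>\<epsilon> \<cdot> F \<tau> G\<close> has to
  be replaced by its image. Since \<open>image_of\<close> and \<open>pullback_of\<close> collect all
  possible choices, it must also be shown that they are complete classes of equivalent
  monomorphisms. Factorization properties serve this purpose because equivalent monomorphisms share
  them.\<close>

lemma Hom_iff: "f \<in> Hom C x y \<longleftrightarrow> f \<in> Arr C \<and> Dom C f = x \<and> Cod C f = y"
  by (auto simp: Hom_def)

lemma Arr_Hom: "f \<in> Arr C \<Longrightarrow> f \<in> Hom C (Dom C f) (Cod C f)"
  by (simp add: Hom_iff)

lemma is_monoI:
  assumes "m \<in> Hom C a x"
    and "\<And>w f g. f \<in> Hom C w a \<Longrightarrow> g \<in> Hom C w a \<Longrightarrow> m \<cdot>\<^bsub>C\<^esub> f = m \<cdot>\<^bsub>C\<^esub> g \<Longrightarrow> f = g"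
  shows "is_mono C m"
  using assms by (auto simp: is_mono_def Hom_iff)

lemma is_monoD:
  assumes "is_mono C m" "m \<in> Hom C a x" "f \<in> Hom C w a" "g \<in> Hom C w a"
    "m \<cdot>\<^bsub>C\<^esub> f = m \<cdot>\<^bsub>C\<^esub> g"
  shows "f = g"
  using assms by (auto simp: is_mono_def Hom_iff)

lemma is_epiD:
  assumes "is_epi C e" "e \<in> Hom C x a" "f \<in> Hom C a w" "g \<in> Hom C a w"
    "f \<cdot>\<^bsub>C\<^esub> e = g \<cdot>\<^bsub>C\<^esub> e"
  shows "f = g"
  using assms by (auto simp: is_epi_def Hom_iff)

text \<open>Uniqueness of liftings is absorbed into \<open>is_mono\<close>, which leaves existence
  as the only part of the universal property to check.\<close>

lemma is_kernelI:
  assumes "f \<in> Hom C x y" "k \<in> Hom C a x" "is_zero_arr C (f \<cdot>\<^bsub>C\<^esub> k)" "is_mono C k"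
    and "\<And>w h. h \<in> Hom C w x \<Longrightarrow> is_zero_arr C (f \<cdot>\<^bsub>C\<^esub> h) \<Longrightarrow>
      \<exists>u \<in> Hom C w a. k \<cdot>\<^bsub>C\<^esub> u = h"
  shows "is_kernel C k f"
  unfolding is_kernel_def
proof (intro conjI ballI impI)
  fix h assume h: "h \<in> Arr C" "Cod C h = Dom C f \<and> is_zero_arr C (f \<cdot>\<^bsub>C\<^esub> h)"
  then obtain u where "u \<in> Hom C (Dom C h) (Dom C k)" "k \<cdot>\<^bsub>C\<^esub> u = h"
    using assms(5)[of h "Dom C h"] assms(1,2) by (auto simp: Hom_iff)
  then show "\<exists>!u. u \<in> Hom C (Dom C h) (Dom C k) \<and> k \<cdot>\<^bsub>C\<^esub> u = h"
    using assms(4) unfolding is_mono_def by metis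
qed (use assms in \<open>auto simp: Hom_iff\<close>)

lemma is_cokernelI:
  assumes "f \<in> Hom C x y" "c \<in> Hom C y a" "is_zero_arr C (c \<cdot>\<^bsub>C\<^esub> f)" "is_epi C c"
    and "\<And>w h. h \<in> Hom C y w \<Longrightarrow> is_zero_arr C (h \<cdot>\<^bsub>C\<^esub> f) \<Longrightarrow>
      \<exists>u \<in> Hom C a w. u \<cdot>\<^bsub>C\<^esub> c = h"
  shows "is_cokernel C c f"
  unfolding is_cokernel_def
proof (intro conjI ballI impI)
  fix h assume h: "h \<in> Arr C" "Dom C h = Cod C f \<and> is_zero_arr C (h \<cdot>\<^bsub>C\<^esub> f)"
  then obtain u where "u \<in> Hom C (Cod C c) (Cod C h)" "u \<cdot>\<^bsub>C\<^esub> c = h"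
    using assms(5)[of h "Cod C h"] assms(1,2) by (auto simp: Hom_iff)
  then show "\<exists>!u. u \<in> Hom C (Cod C c) (Cod C h) \<and> u \<cdot>\<^bsub>C\<^esub> c = h"
    using assms(4) unfolding is_epi_def by metis
qed (use assms in \<open>auto simp: Hom_iff\<close>)

lemma is_kernelD:
  assumes "is_kernel C k f" "h \<in> Hom C w (Dom C f)" "is_zero_arr C (f \<cdot>\<^bsub>C\<^esub> h)"
  shows "\<exists>u \<in> Hom C w (Dom C k). k \<cdot>\<^bsub>C\<^esub> u = h"
proof -
  have h: "h \<in> Arr C" "Cod C h = Dom C f"
    using assms(2) by (auto simp: Hom_iff)
  have "\<exists>!u. u \<in> Hom C (Dom C h) (Dom C k) \<and> k \<cdot>\<^bsub>C\<^esub> u = h"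
    using assms(1,3) h unfolding is_kernel_def by simp
  moreover have "Dom C h = w" using assms(2) by (simp add: Hom_iff)
  ultimately show ?thesis by blast
qed

lemma is_cokernelD:
  assumes "is_cokernel C c f" "h \<in> Hom C (Cod C f) w" "is_zero_arr C (h \<cdot>\<^bsub>C\<^esub> f)"
  shows "\<exists>u \<in> Hom C (Cod C c) w. u \<cdot>\<^bsub>C\<^esub> c = h"
proof -
  have h: "h \<in> Arr C" "Dom C h = Cod C f"
    using assms(2) by (auto simp: Hom_iff)
  have "\<exists>!u. u \<in> Hom C (Cod C c) (Cod C h) \<and> u \<cdot>\<^bsub>C\<^esub> c = h"
    using assms(1,3) h unfolding is_cokernel_def by simp
  moreover have "Cod C h = w" using assms(2) by (simp add: Hom_iff)
  ultimately show ?thesis by blast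
qed

lemma factors_throughI: "u \<in> Hom C (Dom C f) (Dom C g) \<Longrightarrow> g \<cdot>\<^bsub>C\<^esub> u = f \<Longrightarrow> factors_through C f g"
  unfolding factors_through_def by blast

lemma factors_through_iff:
  assumes "f \<in> Hom C a x" "g \<in> Hom C b y"
  shows "factors_through C f g \<longleftrightarrow> (\<exists>u \<in> Hom C a b. f = g \<cdot>\<^bsub>C\<^esub> u)"
  using assms unfolding factors_through_def Hom_iff by auto

context category
begin

lemma Hom_obj: "f \<in> Hom C x y \<Longrightarrow> x \<in> Obj C" "f \<in> Hom C x y \<Longrightarrow> y \<in> Obj C"
  using dom_obj cod_obj by (auto simp: Hom_iff)

lemma factors_through_refl: "f \<in> Arr C \<Longrightarrow> factors_through C f f"
  using cmp_ide[of f "Dom C f" "Cod C f"] ide_hom[of "Dom C f"] dom_obj[of f]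
  by (auto intro!: factors_throughI simp: Hom_iff)

lemma factors_through_trans:
  assumes "factors_through C f g" "factors_through C g h" "h \<in> Arr C"
  shows "factors_through C f h"
proof -
  from assms obtain u v where uv: "u \<in> Hom C (Dom C f) (Dom C g)" "f = g \<cdot> u"
    "v \<in> Hom C (Dom C g) (Dom C h)" "g = h \<cdot> v"
    unfolding factors_through_def by blast
  then have "h \<cdot> (v \<cdot> u) = f"
    using cmp_assoc[OF uv(1,3) Arr_Hom[OF assms(3)]] by simp
  then show ?thesis
    using cmp_hom[OF uv(1,3)] by (auto intro: factors_throughI)
qed

lemma factors_through_mono_trans:
  assumes "factors_through C f g" "factors_through C g h" "is_mono C h"
  shows "factors_through C f h"
  using assms factors_through_trans by (auto simp: is_mono_def)

lemma factors_through_cmp: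
  assumes "factors_through C f g" "f \<in> Hom C a x" "g \<in> Hom C b x" "h \<in> Hom C x y"
  shows "factors_through C (h \<cdot> f) (h \<cdot> g)"
proof -
  from assms obtain u where u: "u \<in> Hom C a b" "f = g \<cdot> u"
    by (auto simp: factors_through_iff)
  then have "h \<cdot> f = (h \<cdot> g) \<cdot> u"
    using cmp_assoc[OF u(1) assms(3,4)] by simp
  then show ?thesis
    using u cmp_hom[OF assms(2,4)] cmp_hom[OF assms(3,4)] by (auto simp: factors_through_iff)
qed

section \<open>Kernels, cokernels and zero arrows\<close>

text \<open>If \<open>k \<cdot> g = k \<cdot> h\<close>, this common arrow is annihilated by
  \<open>f\<close>, because \<open>f \<cdot> k\<close> already passes through a zero object. So
  \<open>g\<close> and \<open>h\<close> are both its unique lifting through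
  \<open>k\<close>.\<close>

lemma kernel_mono:
  assumes "is_kernel C k f"
  shows "is_mono C k"
proof (rule is_monoI)
  show k: "k \<in> Hom C (Dom C k) (Dom C f)"
    using assms by (auto simp: is_kernel_def Hom_iff)
  have f: "f \<in> Hom C (Dom C f) (Cod C f)"
    using assms by (auto simp: is_kernel_def Hom_iff)
  fix w g h assume gh: "g \<in> Hom C w (Dom C k)" "h \<in> Hom C w (Dom C k)" "k \<cdot> g = k \<cdot> h"
  have kg: "k \<cdot> g \<in> Hom C w (Dom C f)"
    using cmp_hom[OF gh(1) k] .
  have "is_zero_arr C (f \<cdot> k)"
    using assms by (simp add: is_kernel_def)
  then obtain z a b where z: "is_zero_obj C z" "a \<in> Hom C (Dom C k) z" "b \<in> Hom C z (Cod C f)"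
    "f \<cdot> k = b \<cdot> a"
    using cmp_hom[OF k f] by (auto simp: is_zero_arr_def Hom_iff)
  have "f \<cdot> (k \<cdot> g) = b \<cdot> (a \<cdot> g)"
    using cmp_assoc[OF gh(1) k f] cmp_assoc[OF gh(1) z(2,3)] z(4) by simp
  moreover have "f \<cdot> (k \<cdot> g) \<in> Hom C w (Cod C f)"
    using cmp_hom[OF kg f] .
  ultimately have "is_zero_arr C (f \<cdot> (k \<cdot> g))"
    using z cmp_hom[OF gh(1) z(2)] unfolding is_zero_arr_def Hom_iff by metis
  then show "g = h"
    using assms kg gh unfolding is_kernel_def Hom_iff by metis
qed

text \<open>Dual to \<open>kernel_mono\<close>.\<close>

lemma cokernel_epi:
  assumes "is_cokernel C c f"
  shows "is_epi C c"
  unfolding is_epi_def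
proof (intro conjI allI ballI impI)
  show "c \<in> Arr C"
    using assms by (auto simp: is_cokernel_def)
  have c: "c \<in> Hom C (Cod C f) (Cod C c)"
    using assms by (auto simp: is_cokernel_def Hom_iff)
  have f: "f \<in> Hom C (Dom C f) (Cod C f)"
    using assms by (auto simp: is_cokernel_def Hom_iff)
  fix w g h assume gh: "g \<in> Hom C (Cod C c) w" "h \<in> Hom C (Cod C c) w" "g \<cdot> c = h \<cdot> c"
  have gc: "g \<cdot> c \<in> Hom C (Cod C f) w"
    using cmp_hom[OF c gh(1)] .
  have "is_zero_arr C (c \<cdot> f)"
    using assms by (simp add: is_cokernel_def)
  then obtain z a b where z: "is_zero_obj C z" "a \<in> Hom C (Dom C f) z" "b \<in> Hom C z (Cod C c)"
    "c \<cdot> f = b \<cdot> a"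
    using cmp_hom[OF f c] by (auto simp: is_zero_arr_def Hom_iff)
  have "(g \<cdot> c) \<cdot> f = (g \<cdot> b) \<cdot> a"
    using cmp_assoc[OF f c gh(1)] cmp_assoc[OF z(2,3) gh(1)] z(4) by simp
  moreover have "(g \<cdot> c) \<cdot> f \<in> Hom C (Dom C f) w"
    using cmp_hom[OF f gc] .
  ultimately have "is_zero_arr C ((g \<cdot> c) \<cdot> f)"
    using z cmp_hom[OF z(3) gh(1)] unfolding is_zero_arr_def Hom_iff by metis
  then show "g = h"
    using assms gc gh unfolding is_cokernel_def Hom_iff by metis
qed

lemma zero_arr_cmp_right:
  assumes "is_zero_arr C f" "f \<in> Hom C x y" "u \<in> Hom C w x"
  shows "is_zero_arr C (f \<cdot> u)"
proof -
  obtain z a b where z: "is_zero_obj C z" "a \<in> Hom C x z" "b \<in> Hom C z y" "f = b \<cdot> a"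
    using assms by (auto simp: is_zero_arr_def Hom_iff)
  then have "f \<cdot> u = b \<cdot> (a \<cdot> u)"
    using cmp_assoc assms by metis
  then show ?thesis
    using z cmp_hom[OF assms(3,2)] cmp_hom[OF assms(3) z(2)]
    unfolding is_zero_arr_def Hom_iff by metis
qed

lemma zero_arr_cmp_left:
  assumes "is_zero_arr C f" "f \<in> Hom C x y" "u \<in> Hom C y w"
  shows "is_zero_arr C (u \<cdot> f)"
proof -
  obtain z a b where z: "is_zero_obj C z" "a \<in> Hom C x z" "b \<in> Hom C z y" "f = b \<cdot> a"
    using assms by (auto simp: is_zero_arr_def Hom_iff)
  then have "u \<cdot> f = (u \<cdot> b) \<cdot> a"
    using cmp_assoc assms by metis
  then show ?thesis
    using z cmp_hom[OF assms(2,3)] cmp_hom[OF z(3) assms(3)]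
    unfolding is_zero_arr_def Hom_iff by metis
qed

text \<open>\<open>is_zero_arr\<close> provides some zero object \<open>z'\<close>, not the given
  one. The comparison arrow \<open>i\<close> from \<open>z\<close> to \<open>z'\<close> translates:
  arrows into \<open>z'\<close> and out of \<open>z\<close> are unique, which gives
  \<open>i \<cdot> a = a'\<close> and \<open>b' \<cdot> i = b\<close>.\<close>

lemma zero_arr_through:
  assumes "is_zero_arr C f" "f \<in> Hom C x y" "is_zero_obj C z" "a \<in> Hom C x z" "b \<in> Hom C z y"
  shows "f = b \<cdot> a"
proof -
  obtain z' a' b' where z': "is_zero_obj C z'" "a' \<in> Hom C x z'" "b' \<in> Hom C z' y" "f = b' \<cdot> a'"
    using assms by (auto simp: is_zero_arr_def Hom_iff)
  have "z \<in> Obj C" using assms(3) by (simp add: is_zero_obj_def)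
  then obtain i where i: "i \<in> Hom C z z'"
    using z'(1) by (auto simp: is_zero_obj_def)
  have "i \<cdot> a = a'"
    using z'(1,2) cmp_hom[OF assms(4) i] Hom_obj[OF assms(4)] by (auto simp: is_zero_obj_def)
  moreover have "b' \<cdot> i = b"
    using assms(3,5) cmp_hom[OF i z'(3)] Hom_obj[OF assms(5)] by (auto simp: is_zero_obj_def)
  ultimately show ?thesis
    using cmp_assoc[OF assms(4) i z'(3)] z'(4) by simp
qed

lemma zero_arr_unique:
  assumes "is_zero_arr C f" "is_zero_arr C g" "f \<in> Hom C x y" "g \<in> Hom C x y"
  shows "f = g"
proof -
  obtain z a b where "is_zero_obj C z" "a \<in> Hom C x z" "b \<in> Hom C z y" "g = b \<cdot> a"
    using assms by (auto simp: is_zero_arr_def Hom_iff)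
  then show ?thesis
    using zero_arr_through[OF assms(1,3)] by blast
qed

section \<open>The partially ordered set of subobjects\<close>

lemma subobj_rel_equiv: "equiv (monos_into C x) (subobj_rel C x)"
proof (rule equivI)
  show "subobj_rel C x \<subseteq> monos_into C x \<times> monos_into C x"
    by (auto simp: subobj_rel_def)
  show "refl_on (monos_into C x) (subobj_rel C x)"
    using factors_through_refl by (auto simp: refl_on_def subobj_rel_def monos_into_def is_mono_def)
  show "sym (subobj_rel C x)"
    by (auto simp: sym_def subobj_rel_def)
  show "trans (subobj_rel C x)"
    unfolding trans_def subobj_rel_def monos_into_def
    by (auto intro: factors_through_mono_trans)
qed

lemma Sub_elem_nonempty: "P \<in> carrier (Sub C x) \<Longrightarrow> \<exists>m. m \<in> P"
  using in_quotient_imp_non_empty[OF subobj_rel_equiv] by (auto simp: Sub_def)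

lemma Sub_elem_mono:
  assumes "P \<in> carrier (Sub C x)" "m \<in> P"
  shows "is_mono C m" "Cod C m = x"
  using assms by (auto simp: Sub_def subobj_rel_def monos_into_def elim!: quotientE)

lemma Sub_elem_factors:
  assumes "P \<in> carrier (Sub C x)" "m \<in> P" "n \<in> P"
  shows "factors_through C m n"
proof -
  have "(m, n) \<in> subobj_rel C x"
    using assms quotient_eq_iff[OF subobj_rel_equiv, of P x P m n] by (auto simp: Sub_def)
  then show ?thesis by (simp add: subobj_rel_def)
qed

text \<open>The criterion by which a set of choices, such as all images of an arrow, is recognized
  as one full equivalence class.\<close>

lemma Sub_carrierI:
  assumes "m \<in> P"
    and "\<And>n. n \<in> P \<longleftrightarrow> is_mono C n \<and> Cod C n = x \<and> factors_through C m n \<and> factors_through C n m"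
  shows "P \<in> carrier (Sub C x)"
proof -
  have "P = subobj_rel C x `` {m}"
    using assms by (auto simp: subobj_rel_def monos_into_def)
  then show ?thesis
    using assms by (auto simp: Sub_def monos_into_def intro: quotientI)
qed

text \<open>The order asks for some pair of representatives; since representatives of one subobject
  factor through each other, any fixed pair decides it.\<close>

lemma Sub_le_iff:
  assumes P: "P \<in> carrier (Sub C x)" "m \<in> P" and Q: "Q \<in> carrier (Sub C x)" "n \<in> Q"
  shows "le (Sub C x) P Q \<longleftrightarrow> factors_through C m n"
proof
  assume "le (Sub C x) P Q"
  then obtain m' n' where *: "m' \<in> P" "n' \<in> Q" "factors_through C m' n'"
    by (auto simp: Sub_def)
  then show "factors_through C m n"
    using Sub_elem_factors[OF P *(1)] Sub_elem_factors[OF Q(1) *(2) Q(2)]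
      factors_through_mono_trans Sub_elem_mono(1)[OF Q(1)] Q(2) by blast
qed (use assms in \<open>auto simp: Sub_def\<close>)

lemma Sub_partial_order: "partial_order (Sub C x)"
proof
  fix P Q R
  assume PQ: "P \<in> carrier (Sub C x)" "Q \<in> carrier (Sub C x)"
  obtain m n where mn: "m \<in> P" "n \<in> Q"
    using PQ Sub_elem_nonempty by blast
  show "le (Sub C x) P P"
    using Sub_le_iff[of P x m P m] PQ mn Sub_elem_factors by blast
  show "eq (Sub C x) P Q" if "le (Sub C x) P Q" "le (Sub C x) Q P"
  proof -
    have "(m, n) \<in> subobj_rel C x"
      using that PQ mn Sub_elem_mono Sub_le_iff by (auto simp: subobj_rel_def monos_into_def)
    then show ?thesis
      using quotient_eq_iff[OF subobj_rel_equiv, of P x Q m n] PQ mn by (simp add: Sub_def)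
  qed
  show "le (Sub C x) P R" if R: "le (Sub C x) P Q" "le (Sub C x) Q R" "R \<in> carrier (Sub C x)"
  proof -
    obtain r where "r \<in> R"
      using R Sub_elem_nonempty by blast
    then show ?thesis
      using R PQ mn Sub_le_iff Sub_elem_mono factors_through_mono_trans by meson
  qed
qed (auto simp: Sub_def)

end

lemma zero_obj_arr:
  assumes "is_zero_obj C z" "x \<in> Obj C"
  shows "\<exists>f. f \<in> Hom C x z" "\<exists>f. f \<in> Hom C z x"
  using assms by (auto simp: is_zero_obj_def)

lemma (in category) zero_arr_exists:
  assumes "is_zero_obj C z" "x \<in> Obj C" "y \<in> Obj C"
  shows "\<exists>f \<in> Hom C x y. is_zero_arr C f"
proof -
  obtain a b where ab: "a \<in> Hom C x z" "b \<in> Hom C z y"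
    using zero_obj_arr assms by metis
  then have ba: "b \<cdot> a \<in> Hom C x y"
    using cmp_hom by blast
  then have "is_zero_arr C (b \<cdot> a)"
    using ab assms(1) unfolding is_zero_arr_def by (auto simp: Hom_iff)
  then show ?thesis using ba by blast
qed

section \<open>Categories with normal monomorphisms\<close>

text \<open>This isolates the part of being abelian from which images and pullbacks of monomorphisms
  are built below. It is established both for abelian categories and for functor categories with
  abelian target.\<close>

locale normal_category = category C for C :: "('o, 'm) category" (structure) +
  assumes kernels: "f \<in> Arr C \<Longrightarrow> \<exists>k. is_kernel C k f"
    and cokernels: "f \<in> Arr C \<Longrightarrow> \<exists>c. is_cokernel C c f"
    and mono_normal: "is_mono C m \<Longrightarrow> \<exists>f. is_kernel C m f"
begin

section \<open>Images\<close>

lemma image_of_nonempty: "f \<in> Arr C \<Longrightarrow> \<exists>m. m \<in> image_of C f"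
proof -
  assume "f \<in> Arr C"
  then obtain c where c: "is_cokernel C c f" using cokernels by blast
  then have "c \<in> Arr C" by (simp add: is_cokernel_def)
  then show ?thesis using c kernels[of c] unfolding image_of_def by blast
qed

lemma image_of_mono:
  assumes "m \<in> image_of C f"
  shows "is_mono C m" "Cod C m = Cod C f"
proof -
  obtain c where c: "is_cokernel C c f" "is_kernel C m c"
    using assms by (auto simp: image_of_def)
  show "is_mono C m" using kernel_mono[OF c(2)] .
  show "Cod C m = Cod C f" using c by (simp add: is_kernel_def is_cokernel_def)
qed

text \<open>With \<open>c\<close> the cokernel of \<open>f\<close> and \<open>m\<close> the kernel
  of \<open>c\<close>, \<open>f\<close> lifts through \<open>m\<close> because
  \<open>c \<cdot> f\<close> is zero; this is one direction. For the other, write \<open>n\<close>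
  as the kernel of some \<open>g\<close>. If \<open>f\<close> factors through \<open>n\<close>, then
  \<open>g \<cdot> f\<close> is zero, so \<open>g\<close> extends along \<open>c\<close>; hence
  \<open>g\<close> annihilates \<open>m\<close> as well, and \<open>m\<close> factors through
  \<open>n\<close>.\<close>

lemma image_of_factors:
  assumes "m \<in> image_of C f" "is_mono C n" "Cod C n = Cod C f"
  shows "factors_through C m n \<longleftrightarrow> factors_through C f n"
proof -
  obtain c where c: "is_cokernel C c f" "is_kernel C m c"
    using assms(1) by (auto simp: image_of_def)
  obtain g where g: "is_kernel C n g"
    using assms(2) mono_normal by blast
  define a x d y l b where "a = Dom C f" and "x = Cod C f" and "d = Cod C c" and "y = Cod C g"
    and "l = Dom C m" and "b = Dom C n"
  note defs = this
  have hom: "f \<in> Hom C a x" "c \<in> Hom C x d" "m \<in> Hom C l x" "n \<in> Hom C b x" "g \<in> Hom C x y"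
    using c g assms(3) by (auto simp: defs Hom_iff is_kernel_def is_cokernel_def)
  have zero: "is_zero_arr C (c \<cdot> f)" "is_zero_arr C (c \<cdot> m)" "is_zero_arr C (g \<cdot> n)"
    using c g by (auto simp: is_kernel_def is_cokernel_def)
  obtain e where e: "e \<in> Hom C a l" "m \<cdot> e = f"
    using is_kernelD[OF c(2) _ zero(1), of a] hom by (auto simp: Hom_iff)
  show ?thesis
  proof
    assume "factors_through C m n"
    moreover have "factors_through C f m"
      using e hom by (auto simp: factors_through_iff)
    ultimately show "factors_through C f n"
      using factors_through_mono_trans assms(2) by blast
  next
    assume "factors_through C f n"
    then obtain u where u: "u \<in> Hom C a b" "f = n \<cdot> u"
      using hom by (auto simp: factors_through_iff)
    have "g \<cdot> f = (g \<cdot> n) \<cdot> u"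
      using cmp_assoc[OF u(1) hom(4,5)] u(2) by simp
    then have "is_zero_arr C (g \<cdot> f)"
      using zero_arr_cmp_right[OF zero(3) cmp_hom[OF hom(4,5)] u(1)] by simp
    then obtain v where v: "v \<in> Hom C d y" "v \<cdot> c = g"
      using is_cokernelD[OF c(1), of g y] hom by (auto simp: Hom_iff)
    have "g \<cdot> m = v \<cdot> (c \<cdot> m)"
      using cmp_assoc[OF hom(3,2) v(1)] v(2) by simp
    then have "is_zero_arr C (g \<cdot> m)"
      using zero_arr_cmp_left[OF zero(2) cmp_hom[OF hom(3,2)] v(1)] by simp
    then show "factors_through C m n"
      using is_kernelD[OF g, of m l] hom by (auto simp: Hom_iff intro: factors_throughI)
  qed
qed

text \<open>The property on the right determines a monomorphism up to mutual factorization.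
  Conversely, if \<open>m\<close> and an actual image \<open>m'\<close> factor through each other,
  then \<open>m\<close> inherits from \<open>m'\<close> the universal property of a kernel of the
  same \<open>c\<close>.\<close>

lemma image_of_iff:
  assumes "f \<in> Arr C"
  shows "m \<in> image_of C f \<longleftrightarrow> is_mono C m \<and> Cod C m = Cod C f \<and>
    (\<forall>n. is_mono C n \<and> Cod C n = Cod C f \<longrightarrow>
      factors_through C m n = factors_through C f n)" (is "_ \<longleftrightarrow> ?P m")
proof
  assume "m \<in> image_of C f"
  then show "?P m"
    using image_of_mono image_of_factors by blast
next
  assume m: "?P m"
  obtain m' where m': "m' \<in> image_of C f"
    using image_of_nonempty[OF assms] by blast
  then obtain c where c: "is_cokernel C c f" "is_kernel C m' c"
    by (auto simp: image_of_def)
  have arr: "m \<in> Arr C" "m' \<in> Arr C"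
    using m m' image_of_mono by (auto simp: is_mono_def)
  have "factors_through C m m'" "factors_through C m' m"
    using m m' image_of_mono[OF m'] image_of_factors[OF m'] factors_through_refl arr by blast+
  then obtain u v where u: "u \<in> Hom C (Dom C m) (Dom C m')" "m = m' \<cdot> u"
    and v: "v \<in> Hom C (Dom C m') (Dom C m)" "m' = m \<cdot> v"
    unfolding factors_through_def by blast
  have hom: "m \<in> Hom C (Dom C m) (Cod C f)" "m' \<in> Hom C (Dom C m') (Cod C f)"
    "c \<in> Hom C (Cod C f) (Cod C c)"
    using m image_of_mono[OF m'] arr c by (auto simp: Hom_iff is_cokernel_def)
  have "is_kernel C m c"
  proof (rule is_kernelI[OF hom(3,1)])
    show "is_mono C m" using m by blast
    have "c \<cdot> m = (c \<cdot> m') \<cdot> u"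
      using cmp_assoc[OF u(1) hom(2,3)] u(2) by simp
    then show "is_zero_arr C (c \<cdot> m)"
      using zero_arr_cmp_right[OF _ cmp_hom[OF hom(2,3)] u(1)] c by (simp add: is_kernel_def)
    fix w h assume h: "h \<in> Hom C w (Cod C f)" "is_zero_arr C (c \<cdot> h)"
    then obtain t where t: "t \<in> Hom C w (Dom C m')" "m' \<cdot> t = h"
      using is_kernelD[OF c(2), of h w] hom by (auto simp: Hom_iff)
    then have "m \<cdot> (v \<cdot> t) = h"
      using cmp_assoc[OF t(1) v(1) hom(1)] v(2) by simp
    then show "\<exists>u \<in> Hom C w (Dom C m). m \<cdot> u = h"
      using cmp_hom[OF t(1) v(1)] by blast
  qed
  then show "m \<in> image_of C f"
    using c by (auto simp: image_of_def)
qed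

text \<open>Equivalent monomorphisms factor through the same monomorphisms, so by
  \<open>image_of_iff\<close> the choices of cokernel and kernel fill exactly one equivalence
  class.\<close>

lemma image_of_Sub:
  assumes "f \<in> Arr C"
  shows "image_of C f \<in> carrier (Sub C (Cod C f))"
proof -
  obtain m where m: "m \<in> image_of C f"
    using image_of_nonempty[OF assms] by blast
  note P = m[unfolded image_of_iff[OF assms]]
  show ?thesis
  proof (rule Sub_carrierI[OF m])
    fix n
    show "n \<in> image_of C f \<longleftrightarrow> is_mono C n \<and> Cod C n = Cod C f \<and>
      factors_through C m n \<and> factors_through C n m"
    proof
      assume "n \<in> image_of C f"
      then have n: "is_mono C n" "Cod C n = Cod C f"
        "\<And>k. is_mono C k \<Longrightarrow> Cod C k = Cod C f \<Longrightarrow>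
          factors_through C n k = factors_through C f k"
        by (simp_all add: image_of_iff[OF assms])
      have "n \<in> Arr C" "m \<in> Arr C"
        using n(1) P by (simp_all add: is_mono_def)
      then show "is_mono C n \<and> Cod C n = Cod C f \<and> factors_through C m n \<and> factors_through C n m"
        using n P factors_through_refl by blast
    next
      assume n: "is_mono C n \<and> Cod C n = Cod C f \<and> factors_through C m n \<and> factors_through C n m"
      have "factors_through C n k = factors_through C m k" if "is_mono C k" for k
        using that n factors_through_mono_trans by blast
      then show "n \<in> image_of C f"
        using n P by (simp add: image_of_iff[OF assms])
    qed
  qed
qed

text \<open>This serves to compare the arrows that arise from two representatives of the same
  preradical.\<close>

lemma image_of_cong:
  assumes "f \<in> Arr C" "g \<in> Arr C" "Cod C f = Cod C g"
    and "\<And>n. is_mono C n \<Longrightarrow> Cod C n = Cod C f \<Longrightarrow> factors_through C f n = factors_through C g n"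
  shows "image_of C f = image_of C g"
  using assms(3,4) unfolding set_eq_iff image_of_iff[OF assms(1)] image_of_iff[OF assms(2)] by simp

section \<open>Pullbacks of monomorphisms\<close>

text \<open>As \<open>g\<close> is mono, the projection \<open>q\<close> is determined by
  \<open>p\<close>, and a cone over \<open>f\<close> and \<open>g\<close> is just an arrow
  \<open>h\<close> such that \<open>f \<cdot> h\<close> factors through \<open>g\<close>. The
  universal property of the square therefore becomes a statement about factorizations through
  \<open>p\<close> alone.\<close>

lemma pullback_of_iff:
  assumes f: "f \<in> Arr C" and g: "is_mono C g" "Cod C g = Cod C f"
  shows "p \<in> pullback_of C f g \<longleftrightarrow> is_mono C p \<and> Cod C p = Dom C f \<and>
    (\<forall>h \<in> Arr C. Cod C h = Dom C f \<longrightarrow>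
      factors_through C h p = factors_through C (f \<cdot> h) g)" (is "_ \<longleftrightarrow> ?P p")
proof
  have fH: "f \<in> Hom C (Dom C f) (Cod C f)" and gH: "g \<in> Hom C (Dom C g) (Cod C f)"
    using f g by (auto simp: Hom_iff is_mono_def)
  {
    assume "p \<in> pullback_of C f g"
    then obtain q where pq: "is_pullback C p q f g"
      by (auto simp: pullback_of_def)
    have pH: "p \<in> Hom C (Dom C p) (Dom C f)" and qH: "q \<in> Hom C (Dom C p) (Dom C g)"
      and sq: "f \<cdot> p = g \<cdot> q"
      using pq by (auto simp: is_pullback_def Hom_iff)
    have ex: "\<exists>!u. u \<in> Hom C w (Dom C p) \<and> p \<cdot> u = a \<and> q \<cdot> u = b"
      if "a \<in> Hom C w (Dom C f)" "b \<in> Hom C w (Dom C g)" "f \<cdot> a = g \<cdot> b" for a b w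
      using pq that unfolding is_pullback_def by blast
    have "is_mono C p"
    proof (rule is_monoI[OF pH])
      fix w s t assume st: "s \<in> Hom C w (Dom C p)" "t \<in> Hom C w (Dom C p)" "p \<cdot> s = p \<cdot> t"
      have "g \<cdot> (q \<cdot> s) = f \<cdot> (p \<cdot> s)"
        using cmp_assoc[OF st(1) pH fH] cmp_assoc[OF st(1) qH gH] sq by simp
      moreover have "g \<cdot> (q \<cdot> t) = f \<cdot> (p \<cdot> t)"
        using cmp_assoc[OF st(2) pH fH] cmp_assoc[OF st(2) qH gH] sq by simp
      \<comment> \<open>Equality of the second projections is not given; it comes from cancelling
        the monomorphism \<open>g\<close>. Then \<open>s\<close> and \<open>t\<close> induce the
        same cone.\<close>
      ultimately have "q \<cdot> s = q \<cdot> t"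
        using is_monoD[OF g(1) gH cmp_hom[OF st(1) qH] cmp_hom[OF st(2) qH]] st(3) by simp
      then show "s = t"
        using ex[OF cmp_hom[OF st(1) pH] cmp_hom[OF st(1) qH]] st
          \<open>g \<cdot> (q \<cdot> s) = f \<cdot> (p \<cdot> s)\<close> by metis
    qed
    moreover have "factors_through C h p = factors_through C (f \<cdot> h) g"
      if "h \<in> Arr C" "Cod C h = Dom C f" for h
    proof -
      have h: "h \<in> Hom C (Dom C h) (Dom C f)"
        using that by (simp add: Hom_iff)
      show ?thesis
        unfolding factors_through_iff[OF h pH] factors_through_iff[OF cmp_hom[OF h fH] gH]
      proof
        assume "\<exists>u \<in> Hom C (Dom C h) (Dom C p). h = p \<cdot> u"
        then obtain u where u: "u \<in> Hom C (Dom C h) (Dom C p)" "h = p \<cdot> u" by blast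
        then have "f \<cdot> h = g \<cdot> (q \<cdot> u)"
          using cmp_assoc[OF u(1) pH fH] cmp_assoc[OF u(1) qH gH] sq by simp
        then show "\<exists>u \<in> Hom C (Dom C h) (Dom C g). f \<cdot> h = g \<cdot> u"
          using cmp_hom[OF u(1) qH] by blast
      next
        assume "\<exists>u \<in> Hom C (Dom C h) (Dom C g). f \<cdot> h = g \<cdot> u"
        then show "\<exists>u \<in> Hom C (Dom C h) (Dom C p). h = p \<cdot> u"
          using ex[OF h] by metis
      qed
    qed
    ultimately show "?P p"
      using pH by (auto simp: Hom_iff)
  }
  assume P: "?P p"
  then have pH: "p \<in> Hom C (Dom C p) (Dom C f)" and p: "is_mono C p"
    by (auto simp: is_mono_def Hom_iff)
  then have "factors_through C (f \<cdot> p) g"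
    using P factors_through_refl by (auto simp: Hom_iff)
  then obtain q where q: "q \<in> Hom C (Dom C p) (Dom C g)" "f \<cdot> p = g \<cdot> q"
    using factors_through_iff[OF cmp_hom[OF pH fH] gH] by blast
  have "is_pullback C p q f g"
    unfolding is_pullback_def
  proof (intro conjI allI impI)
    fix a b w assume ab: "a \<in> Hom C w (Dom C f) \<and> b \<in> Hom C w (Dom C g) \<and> f \<cdot> a = g \<cdot> b"
    then have a: "a \<in> Hom C w (Dom C f)" and b: "b \<in> Hom C w (Dom C g)" by auto
    have "factors_through C (f \<cdot> a) g"
      using factors_through_iff[OF cmp_hom[OF a fH] gH] ab by blast
    then have "factors_through C a p"
      using P a by (auto simp: Hom_iff)
    then obtain u where u: "u \<in> Hom C w (Dom C p)" "a = p \<cdot> u"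
      using factors_through_iff[OF a pH] by blast
    then have "g \<cdot> (q \<cdot> u) = g \<cdot> b"
      using ab cmp_assoc[OF u(1) pH fH] cmp_assoc[OF u(1) q(1) gH] q(2) by simp
    then have "q \<cdot> u = b"
      using is_monoD[OF g(1) gH cmp_hom[OF u(1) q(1)] b] by blast
    then show "\<exists>!u. u \<in> Hom C w (Dom C p) \<and> p \<cdot> u = a \<and> q \<cdot> u = b"
      using u is_monoD[OF p pH] by metis
  qed (use f g pH q in \<open>auto simp: Hom_iff is_mono_def\<close>)
  then show "p \<in> pullback_of C f g"
    by (auto simp: pullback_of_def)
qed

text \<open>If \<open>g\<close> is the kernel of \<open>c\<close>, then the kernel of \<open>c \<cdot> f\<close> is the pullback of \<open>g\<close> along \<open>f\<close>.\<close>

lemma pullback_of_nonempty: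
  assumes f: "f \<in> Arr C" and g: "is_mono C g" "Cod C g = Cod C f"
  shows "\<exists>p. p \<in> pullback_of C f g"
proof -
  obtain c where c: "is_kernel C g c"
    using mono_normal[OF g(1)] by blast
  have fH: "f \<in> Hom C (Dom C f) (Cod C f)" and gH: "g \<in> Hom C (Dom C g) (Cod C f)"
    and cH: "c \<in> Hom C (Cod C f) (Cod C c)"
    using f g c by (auto simp: Hom_iff is_mono_def is_kernel_def)
  note cf = cmp_hom[OF fH cH]
  then obtain p where p: "is_kernel C p (c \<cdot> f)"
    using kernels by (auto simp: Hom_iff)
  have pH: "p \<in> Hom C (Dom C p) (Dom C f)"
    using p cf by (auto simp: Hom_iff is_kernel_def)
  have "factors_through C h p = factors_through C (f \<cdot> h) g" if "h \<in> Arr C" "Cod C h = Dom C f" for h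
  proof -
    have h: "h \<in> Hom C (Dom C h) (Dom C f)"
      using that by (simp add: Hom_iff)
    have ass: "(c \<cdot> f) \<cdot> h = c \<cdot> (f \<cdot> h)"
      using cmp_assoc[OF h fH cH] .
    show ?thesis
      unfolding factors_through_iff[OF h pH] factors_through_iff[OF cmp_hom[OF h fH] gH]
    proof
      assume "\<exists>u \<in> Hom C (Dom C h) (Dom C p). h = p \<cdot> u"
      then obtain u where u: "u \<in> Hom C (Dom C h) (Dom C p)" "h = p \<cdot> u" by blast
      have "is_zero_arr C (((c \<cdot> f) \<cdot> p) \<cdot> u)"
        using zero_arr_cmp_right[OF _ cmp_hom[OF pH cf] u(1)] p by (simp add: is_kernel_def)
      then have "is_zero_arr C (c \<cdot> (f \<cdot> h))"
        using cmp_assoc[OF u(1) pH cf] u(2) ass by simp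
      moreover have "f \<cdot> h \<in> Hom C (Dom C h) (Dom C c)"
        using cmp_hom[OF h fH] cH by (simp add: Hom_iff)
      ultimately show "\<exists>u \<in> Hom C (Dom C h) (Dom C g). f \<cdot> h = g \<cdot> u"
        using is_kernelD[OF c, of "f \<cdot> h" "Dom C h"] by metis
    next
      assume "\<exists>u \<in> Hom C (Dom C h) (Dom C g). f \<cdot> h = g \<cdot> u"
      then obtain u where u: "u \<in> Hom C (Dom C h) (Dom C g)" "f \<cdot> h = g \<cdot> u" by blast
      have "is_zero_arr C ((c \<cdot> g) \<cdot> u)"
        using zero_arr_cmp_right[OF _ cmp_hom[OF gH cH] u(1)] c by (simp add: is_kernel_def)
      then have "is_zero_arr C ((c \<cdot> f) \<cdot> h)"
        using cmp_assoc[OF u(1) gH cH] u(2) ass by simp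
      then show "\<exists>u \<in> Hom C (Dom C h) (Dom C p). h = p \<cdot> u"
        using is_kernelD[OF p, of h "Dom C h"] h cf by (auto simp: Hom_iff)
    qed
  qed
  then have "p \<in> pullback_of C f g"
    using pullback_of_iff[OF assms] kernel_mono[OF p] pH by (auto simp: Hom_iff)
  then show ?thesis by blast
qed

lemma pullback_of_Sub:
  assumes "f \<in> Arr C" "is_mono C g" "Cod C g = Cod C f"
  shows "pullback_of C f g \<in> carrier (Sub C (Dom C f))"
proof -
  obtain p where p: "p \<in> pullback_of C f g"
    using pullback_of_nonempty[OF assms] by blast
  note P = p[unfolded pullback_of_iff[OF assms]]
  show ?thesis
  proof (rule Sub_carrierI[OF p])
    fix n
    show "n \<in> pullback_of C f g \<longleftrightarrow> is_mono C n \<and> Cod C n = Dom C f \<and>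
      factors_through C p n \<and> factors_through C n p"
    proof
      assume "n \<in> pullback_of C f g"
      then have n: "is_mono C n" "Cod C n = Dom C f"
        "\<And>h. h \<in> Arr C \<Longrightarrow> Cod C h = Dom C f \<Longrightarrow>
          factors_through C h n = factors_through C (f \<cdot> h) g"
        by (simp_all add: pullback_of_iff[OF assms])
      have "n \<in> Arr C" "p \<in> Arr C"
        using n(1) P by (simp_all add: is_mono_def)
      then show "is_mono C n \<and> Cod C n = Dom C f \<and> factors_through C p n \<and> factors_through C n p"
        using n P factors_through_refl by blast
    next
      assume n: "is_mono C n \<and> Cod C n = Dom C f \<and> factors_through C p n \<and> factors_through C n p"
      have "factors_through C h n = factors_through C h p" for h
        using n P factors_through_mono_trans by blast
      then show "n \<in> pullback_of C f g"
        using n P by (simp add: pullback_of_iff[OF assms])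
    qed
  qed
qed

text \<open>In \<open>pullback_of_iff\<close> the arrow \<open>g\<close> enters only through the
  question which arrows \<open>f \<cdot> h\<close> factor through it.\<close>

lemma pullback_of_cong:
  assumes "f \<in> Arr C" "is_mono C g" "Cod C g = Cod C f" "is_mono C g'" "Cod C g' = Cod C f"
    and "\<And>h. h \<in> Arr C \<Longrightarrow> Cod C h = Dom C f \<Longrightarrow>
      factors_through C (f \<cdot> h) g = factors_through C (f \<cdot> h) g'"
  shows "pullback_of C f g = pullback_of C f g'"
  using assms(6) unfolding set_eq_iff pullback_of_iff[OF assms(1-3)] pullback_of_iff[OF assms(1,4,5)]
  by simp

end

section \<open>Normality and zero kernels in abelian categories\<close>

text \<open>Normality gives only some \<open>g\<close> of which \<open>m\<close> is the kernel.
  Since \<open>g\<close> extends along the cokernel \<open>c\<close>, whatever \<open>c\<close>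
  annihilates is annihilated by \<open>g\<close> too. Having \<open>c\<close> itself in place of an
  unspecified \<open>g\<close> is what allows normality to be assembled from components in a functor
  category.\<close>

lemma (in normal_category) mono_kernel_of_cokernel:
  assumes "is_mono C m" "is_cokernel C c m"
  shows "is_kernel C m c"
proof -
  have m: "m \<in> Hom C (Dom C m) (Cod C m)" and c: "c \<in> Hom C (Cod C m) (Cod C c)"
    and zero: "is_zero_arr C (c \<cdot> m)"
    using assms by (auto simp: is_cokernel_def Hom_iff)
  obtain g where g: "is_kernel C m g"
    using mono_normal[OF assms(1)] by blast
  then have gH: "g \<in> Hom C (Cod C m) (Cod C g)" and "is_zero_arr C (g \<cdot> m)"
    by (auto simp: is_kernel_def Hom_iff)
  then obtain v where v: "v \<in> Hom C (Cod C c) (Cod C g)" "v \<cdot> c = g"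
    using is_cokernelD[OF assms(2)] by blast
  show ?thesis
  proof (rule is_kernelI[OF c m zero assms(1)])
    fix w h assume h: "h \<in> Hom C w (Cod C m)" "is_zero_arr C (c \<cdot> h)"
    have "g \<cdot> h = v \<cdot> (c \<cdot> h)"
      using cmp_assoc[OF h(1) c v(1)] v(2) by simp
    then have "is_zero_arr C (g \<cdot> h)"
      using zero_arr_cmp_left[OF h(2) cmp_hom[OF h(1) c] v(1)] by simp
    then show "\<exists>u \<in> Hom C w (Dom C m). m \<cdot> u = h"
      using is_kernelD[OF g, of h w] h(1) gH by (simp add: Hom_iff)
  qed
qed

sublocale abelian_category \<subseteq> normal: normal_category C
  using kernels cokernels mono_normal by unfold_locales auto

text \<open>If \<open>f\<close> equalizes \<open>g\<close> and \<open>h\<close>, it annihilates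
  their difference, which then lifts through the zero arrow \<open>k\<close> and so is zero. The
  work lies in identifying the neutral element of a hom group with the zero arrow.\<close>

lemma (in abelian_category) mono_if_zero_kernel:
  assumes k: "is_kernel C k f" "is_zero_arr C k"
  shows "is_mono C f"
proof (rule is_monoI)
  show f: "f \<in> Hom C (Dom C f) (Cod C f)"
    using k by (simp add: is_kernel_def Hom_iff)
  have kH: "k \<in> Hom C (Dom C k) (Dom C f)"
    using k by (simp add: is_kernel_def Hom_iff)
  fix w g h assume g: "g \<in> Hom C w (Dom C f)" and h: "h \<in> Hom C w (Dom C f)"
    and fgh: "f \<cdot> g = f \<cdot> h"
  obtain z where z: "is_zero_obj C z" using zero_object by blast
  obtain add where add: "preadditive C add" using additive by blast
  have grp: "\<exists>e. comm_group \<lparr>carrier = Hom C x y, mult = add, one = e\<rparr>"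
    if "x \<in> Obj C" "y \<in> Obj C" for x y
    using add that by (auto simp: preadditive_def)
  have dist: "b \<cdot> add a a' = add (b \<cdot> a) (b \<cdot> a')"
    if "a \<in> Hom C x y" "a' \<in> Hom C x y" "b \<in> Hom C y v" for a a' b x y v
    using add that unfolding preadditive_def by blast
  have objs: "w \<in> Obj C" "Dom C f \<in> Obj C" "Cod C f \<in> Obj C" "z \<in> Obj C"
    using Hom_obj f g z by (auto simp: is_zero_obj_def)
  obtain e where "comm_group \<lparr>carrier = Hom C w (Dom C f), mult = add, one = e\<rparr>" (is "comm_group ?G")
    using grp objs by blast
  then interpret G: comm_group ?G .
  obtain a b where ab: "a \<in> Hom C w z" "b \<in> Hom C z (Dom C f)"
    using zero_obj_arr[OF z] objs(1,2) by metis
  obtain e' where "comm_group \<lparr>carrier = Hom C w z, mult = add, one = e'\<rparr>" (is "comm_group ?H")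
    using grp objs by blast
  then interpret H: comm_group ?H .
  have ba: "b \<cdot> a \<in> Hom C w (Dom C f)" using cmp_hom ab by blast
  \<comment> \<open>There is only one arrow from \<open>w\<close> to \<open>z\<close>. Hence
    \<open>b \<cdot> a\<close> is idempotent under \<open>add\<close>, and an idempotent element of
    a group is neutral; this makes \<open>e\<close> a zero arrow.\<close>
  have "add a a = a"
    using z ab(1) objs(1) H.m_closed[of a a] unfolding is_zero_obj_def by auto
  then have "add (b \<cdot> a) (b \<cdot> a) = b \<cdot> a"
    using dist[OF ab(1,1,2)] by simp
  then have e: "b \<cdot> a = e"
    using G.l_cancel_one[of "b \<cdot> a" "b \<cdot> a"] ba by simp
  have zero: "is_zero_arr C e"
    using e ab ba z unfolding is_zero_arr_def by (auto simp: Hom_iff)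
  define i where "i = inv\<^bsub>?G\<^esub> h"
  have i: "i \<in> Hom C w (Dom C f)" "add h i = e"
    using G.inv_closed[of h] G.r_inv[of h] h by (auto simp: i_def)
  have d: "add g i \<in> Hom C w (Dom C f)"
    using G.m_closed[of g i] g i by simp
  \<comment> \<open>Both sides equal \<open>add (f \<cdot> h) (f \<cdot> i)\<close>, so
    distributivity suffices and no inverse in the target hom group has to be computed.\<close>
  have "f \<cdot> add g i = f \<cdot> e"
    using dist[OF g i(1) f] dist[OF h i(1) f] fgh i(2) by simp
  moreover have "is_zero_arr C (f \<cdot> e)"
    using zero_arr_cmp_left[OF zero _ f] e ba by simp
  ultimately obtain u where u: "u \<in> Hom C w (Dom C k)" "k \<cdot> u = add g i"
    using is_kernelD[OF k(1) d] by auto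
  then have "is_zero_arr C (add g i)"
    using zero_arr_cmp_right[OF k(2) kH u(1)] by simp
  then have "add g i = add h i"
    using zero_arr_unique[OF _ zero d] e ba i(2) by simp
  then show "g = h"
    using G.right_cancel[of i g h] g h i by simp
qed

section \<open>Functor categories\<close>

lemma functor_obj: "is_functor C D F \<Longrightarrow> x \<in> Obj C \<Longrightarrow> fobj F x \<in> Obj D"
  by (auto simp: is_functor_def)

lemma functor_arr: "is_functor C D F \<Longrightarrow> f \<in> Hom C x y \<Longrightarrow> farr F f \<in> Hom D (fobj F x) (fobj F y)"
  by (auto simp: is_functor_def)

lemma functor_ide: "is_functor C D F \<Longrightarrow> x \<in> Obj C \<Longrightarrow> farr F (Ide C x) = Ide D (fobj F x)"
  by (auto simp: is_functor_def)

lemma functor_cmp: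
  "is_functor C D F \<Longrightarrow> f \<in> Hom C x y \<Longrightarrow> g \<in> Hom C y z \<Longrightarrow>
    farr F (g \<cdot>\<^bsub>C\<^esub> f) = farr F g \<cdot>\<^bsub>D\<^esub> farr F f"
  unfolding is_functor_def by blast

lemma nat_tr_functor:
  "is_nat_tr C D \<tau> \<Longrightarrow> is_functor C D (src \<tau>)"
  "is_nat_tr C D \<tau> \<Longrightarrow> is_functor C D (trg \<tau>)"
  by (auto simp: is_nat_tr_def)

lemma nat_tr_cmpt:
  "is_nat_tr C D \<tau> \<Longrightarrow> x \<in> Obj C \<Longrightarrow> cmpt \<tau> x \<in> Hom D (fobj (src \<tau>) x) (fobj (trg \<tau>) x)"
  by (auto simp: is_nat_tr_def)

lemma nat_tr_natural:
  "is_nat_tr C D \<tau> \<Longrightarrow> f \<in> Hom C x y \<Longrightarrow>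
    cmpt \<tau> y \<cdot>\<^bsub>D\<^esub> farr (src \<tau>) f = farr (trg \<tau>) f \<cdot>\<^bsub>D\<^esub> cmpt \<tau> x"
  by (auto simp: is_nat_tr_def)

text \<open>Extensionality makes agreement of the components on \<open>Obj C\<close> into equality
  of functions.\<close>

lemma nat_tr_eqI:
  fixes \<sigma> \<tau> :: "('o, 'm, 'p, 'n) nat_tr"
  assumes "is_nat_tr C D \<sigma>" "is_nat_tr C D \<tau>" "src \<sigma> = src \<tau>" "trg \<sigma> = trg \<tau>"
    "\<And>x. x \<in> Obj C \<Longrightarrow> cmpt \<sigma> x = cmpt \<tau> x"
  shows "\<sigma> = \<tau>"
proof -
  have "cmpt \<sigma> = cmpt \<tau>"
    using assms by (auto simp: is_nat_tr_def intro: extensionalityI)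
  then show ?thesis using assms by simp
qed

lemma Fun_simps [simp]:
  "Obj (Fun C D) = {F. is_functor C D F}" "Arr (Fun C D) = {\<tau>. is_nat_tr C D \<tau>}"
  "Dom (Fun C D) = src" "Cod (Fun C D) = trg"
  "src (Ide (Fun C D) F) = F" "trg (Ide (Fun C D) F) = F"
  "src (\<sigma> \<cdot>\<^bsub>Fun C D\<^esub> \<tau>) = src \<tau>" "trg (\<sigma> \<cdot>\<^bsub>Fun C D\<^esub> \<tau>) = trg \<sigma>"
  by (simp_all add: Fun_def)

lemma Fun_ide_cmpt [simp]: "x \<in> Obj C \<Longrightarrow> cmpt (Ide (Fun C D) F) x = Ide D (fobj F x)"
  by (simp add: Fun_def)

lemma Fun_cmp_cmpt [simp]: "x \<in> Obj C \<Longrightarrow> cmpt (\<sigma> \<cdot>\<^bsub>Fun C D\<^esub> \<tau>) x = cmpt \<sigma> x \<cdot>\<^bsub>D\<^esub> cmpt \<tau> x"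
  by (simp add: Fun_def)

lemma Fun_Hom: "\<tau> \<in> Hom (Fun C D) F G \<longleftrightarrow> is_nat_tr C D \<tau> \<and> src \<tau> = F \<and> trg \<tau> = G"
  by (simp add: Hom_iff)

locale functor_category = C: category C + D: abelian_category D
  for C :: "('o, 'm) category" and D :: "('p, 'n) category"
begin

section \<open>The category of functors and natural transformations\<close>

lemma nat_tr_ide:
  assumes F: "is_functor C D F"
  shows "is_nat_tr C D (Ide (Fun C D) F)"
  unfolding is_nat_tr_def
proof (intro conjI allI ballI)
  show "cmpt (Ide (Fun C D) F) \<in> extensional (Obj C)"
    by (simp add: Fun_def)
  show "cmpt (Ide (Fun C D) F) x \<in> Hom D (fobj (src (Ide (Fun C D) F)) x) (fobj (trg (Ide (Fun C D) F)) x)"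
    if "x \<in> Obj C" for x
    using that D.ide_hom functor_obj[OF F] by simp
  fix x y f assume f: "f \<in> Hom C x y"
  then show "cmpt (Ide (Fun C D) F) y \<cdot>\<^bsub>D\<^esub> farr (src (Ide (Fun C D) F)) f =
      farr (trg (Ide (Fun C D) F)) f \<cdot>\<^bsub>D\<^esub> cmpt (Ide (Fun C D) F) x"
    using functor_arr[OF F f] D.cmp_ide D.ide_cmp C.Hom_obj[OF f] by simp
qed (use F in simp_all)

lemma nat_tr_cmp:
  assumes \<tau>: "is_nat_tr C D \<tau>" and \<sigma>: "is_nat_tr C D \<sigma>" and eq: "trg \<tau> = src \<sigma>"
  shows "is_nat_tr C D (\<sigma> \<cdot>\<^bsub>Fun C D\<^esub> \<tau>)"
  unfolding is_nat_tr_def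
proof (intro conjI allI ballI)
  show "cmpt (\<sigma> \<cdot>\<^bsub>Fun C D\<^esub> \<tau>) \<in> extensional (Obj C)"
    by (simp add: Fun_def)
  show "cmpt (\<sigma> \<cdot>\<^bsub>Fun C D\<^esub> \<tau>) x \<in> Hom D (fobj (src (\<sigma> \<cdot>\<^bsub>Fun C D\<^esub> \<tau>)) x) (fobj (trg (\<sigma> \<cdot>\<^bsub>Fun C D\<^esub> \<tau>)) x)"
    if x: "x \<in> Obj C" for x
    using D.cmp_hom[OF nat_tr_cmpt[OF \<tau> x, unfolded eq] nat_tr_cmpt[OF \<sigma> x]] x by simp
  fix x y f assume f: "f \<in> Hom C x y"
  have xy: "x \<in> Obj C" "y \<in> Obj C"
    using C.Hom_obj[OF f] .
  note t = nat_tr_cmpt[OF \<tau>, unfolded eq]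
    and s = nat_tr_cmpt[OF \<sigma>]
  note Sf = functor_arr[OF nat_tr_functor(1)[OF \<tau>] f]
    and Tf = functor_arr[OF nat_tr_functor(1)[OF \<sigma>] f]
    and Uf = functor_arr[OF nat_tr_functor(2)[OF \<sigma>] f]
  have "(cmpt \<sigma> y \<cdot>\<^bsub>D\<^esub> cmpt \<tau> y) \<cdot>\<^bsub>D\<^esub> farr (src \<tau>) f = cmpt \<sigma> y \<cdot>\<^bsub>D\<^esub> farr (trg \<tau>) f \<cdot>\<^bsub>D\<^esub> cmpt \<tau> x"
    using D.cmp_assoc[OF Sf t[OF xy(2)] s[OF xy(2)]] nat_tr_natural[OF \<tau> f] by simp
  also have "\<dots> = farr (trg \<sigma>) f \<cdot>\<^bsub>D\<^esub> (cmpt \<sigma> x \<cdot>\<^bsub>D\<^esub> cmpt \<tau> x)"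
    using D.cmp_assoc[OF t[OF xy(1)] Tf s[OF xy(2)]] nat_tr_natural[OF \<sigma> f]
      D.cmp_assoc[OF t[OF xy(1)] s[OF xy(1)] Uf] eq by simp
  finally show "cmpt (\<sigma> \<cdot>\<^bsub>Fun C D\<^esub> \<tau>) y \<cdot>\<^bsub>D\<^esub> farr (src (\<sigma> \<cdot>\<^bsub>Fun C D\<^esub> \<tau>)) f =
      farr (trg (\<sigma> \<cdot>\<^bsub>Fun C D\<^esub> \<tau>)) f \<cdot>\<^bsub>D\<^esub> cmpt (\<sigma> \<cdot>\<^bsub>Fun C D\<^esub> \<tau>) x"
    using xy by simp
qed (use assms in \<open>simp_all add: is_nat_tr_def\<close>)

sublocale Fun: category "Fun C D"
proof
  fix F assume "F \<in> Obj (Fun C D)"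
  then show "Ide (Fun C D) F \<in> Hom (Fun C D) F F"
    using nat_tr_ide by (simp add: Fun_Hom)
next
  fix f x y g z assume "f \<in> Hom (Fun C D) x y" "g \<in> Hom (Fun C D) y z"
  then show "g \<cdot>\<^bsub>Fun C D\<^esub> f \<in> Hom (Fun C D) x z"
    using nat_tr_cmp by (auto simp: Fun_Hom)
next
  fix f x y assume "f \<in> Hom (Fun C D) x y"
  then have f: "is_nat_tr C D f" "src f = x" "trg f = y" by (auto simp: Fun_Hom)
  note xy = nat_tr_functor[OF f(1), unfolded f(2,3)]
  show "f \<cdot>\<^bsub>Fun C D\<^esub> Ide (Fun C D) x = f"
    using f nat_tr_cmp[OF nat_tr_ide[OF xy(1)] f(1)] D.cmp_ide[OF nat_tr_cmpt[OF f(1)]]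
    by (intro nat_tr_eqI[of C D]) auto
  show "Ide (Fun C D) y \<cdot>\<^bsub>Fun C D\<^esub> f = f"
    using f nat_tr_cmp[OF f(1) nat_tr_ide[OF xy(2)]] D.ide_cmp[OF nat_tr_cmpt[OF f(1)]]
    by (intro nat_tr_eqI[of C D]) auto
next
  fix f w x g y h z
  assume "f \<in> Hom (Fun C D) w x" "g \<in> Hom (Fun C D) x y" "h \<in> Hom (Fun C D) y z"
  then have fgh: "is_nat_tr C D f" "is_nat_tr C D g" "is_nat_tr C D h"
    and eq: "trg f = x" "src g = x" "trg g = y" "src h = y" by (auto simp: Fun_Hom)
  show "(h \<cdot>\<^bsub>Fun C D\<^esub> g) \<cdot>\<^bsub>Fun C D\<^esub> f = h \<cdot>\<^bsub>Fun C D\<^esub> (g \<cdot>\<^bsub>Fun C D\<^esub> f)"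
    using fgh eq D.cmp_assoc[OF nat_tr_cmpt[OF fgh(1), unfolded eq] nat_tr_cmpt[OF fgh(2), unfolded eq]
        nat_tr_cmpt[OF fgh(3), unfolded eq]]
    by (intro nat_tr_eqI[of C D] nat_tr_cmp) auto
qed (auto simp: is_nat_tr_def)

section \<open>Gluing componentwise constructions\<close>

lemma Fun_monoI:
  assumes n: "is_nat_tr C D n" and mono: "\<And>x. x \<in> Obj C \<Longrightarrow> is_mono D (cmpt n x)"
  shows "is_mono (Fun C D) n"
proof (rule is_monoI)
  show "n \<in> Hom (Fun C D) (src n) (trg n)" using n by (simp add: Fun_Hom)
  fix W f g assume "f \<in> Hom (Fun C D) W (src n)" "g \<in> Hom (Fun C D) W (src n)"
    and eq: "n \<cdot>\<^bsub>Fun C D\<^esub> f = n \<cdot>\<^bsub>Fun C D\<^esub> g"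
  then have f: "is_nat_tr C D f" "src f = W" "trg f = src n"
    and g: "is_nat_tr C D g" "src g = W" "trg g = src n" by (auto simp: Fun_Hom)
  show "f = g"
  proof (rule nat_tr_eqI[OF f(1) g(1)])
    fix x assume x: "x \<in> Obj C"
    have "cmpt n x \<cdot>\<^bsub>D\<^esub> cmpt f x = cmpt n x \<cdot>\<^bsub>D\<^esub> cmpt g x"
      using arg_cong[OF eq, of "\<lambda>\<tau>. cmpt \<tau> x"] x by simp
    then show "cmpt f x = cmpt g x"
      using is_monoD[OF mono[OF x] nat_tr_cmpt[OF n x]] nat_tr_cmpt[OF f(1) x] nat_tr_cmpt[OF g(1) x] f g
      by simp
  qed (use f g in simp_all)
qed

lemma Fun_epiI:
  assumes n: "is_nat_tr C D n" and epi: "\<And>x. x \<in> Obj C \<Longrightarrow> is_epi D (cmpt n x)"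
  shows "is_epi (Fun C D) n"
  unfolding is_epi_def
proof (intro conjI allI ballI impI)
  show "n \<in> Arr (Fun C D)" using n by simp
  fix W f g assume "f \<in> Hom (Fun C D) (Cod (Fun C D) n) W" "g \<in> Hom (Fun C D) (Cod (Fun C D) n) W"
    and eq: "f \<cdot>\<^bsub>Fun C D\<^esub> n = g \<cdot>\<^bsub>Fun C D\<^esub> n"
  then have f: "is_nat_tr C D f" "src f = trg n" "trg f = W"
    and g: "is_nat_tr C D g" "src g = trg n" "trg g = W" by (auto simp: Fun_Hom)
  show "f = g"
  proof (rule nat_tr_eqI[OF f(1) g(1)])
    fix x assume x: "x \<in> Obj C"
    have "cmpt f x \<cdot>\<^bsub>D\<^esub> cmpt n x = cmpt g x \<cdot>\<^bsub>D\<^esub> cmpt n x"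
      using arg_cong[OF eq, of "\<lambda>\<tau>. cmpt \<tau> x"] x by simp
    then show "cmpt f x = cmpt g x"
      using is_epiD[OF epi[OF x] nat_tr_cmpt[OF n x]] nat_tr_cmpt[OF f(1) x] nat_tr_cmpt[OF g(1) x] f g
      by simp
  qed (use f g in simp_all)
qed

text \<open>A family of componentwise liftings through a monomorphism is automatically natural.\<close>

lemma Fun_factors_throughI:
  assumes n: "is_nat_tr C D n" and mono: "\<And>x. x \<in> Obj C \<Longrightarrow> is_mono D (cmpt n x)"
    and h: "is_nat_tr C D h" "trg h = trg n"
    and ft: "\<And>x. x \<in> Obj C \<Longrightarrow> factors_through D (cmpt h x) (cmpt n x)"
  shows "factors_through (Fun C D) h n"
proof -
  note hH = nat_tr_cmpt[OF h(1)] and nH = nat_tr_cmpt[OF n, folded h(2)]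
  have "\<forall>x \<in> Obj C. \<exists>u. u \<in> Hom D (fobj (src h) x) (fobj (src n) x) \<and> cmpt h x = cmpt n x \<cdot>\<^bsub>D\<^esub> u"
    using ft factors_through_iff[OF hH nH] by blast
  then obtain u where u: "\<And>x. x \<in> Obj C \<Longrightarrow> u x \<in> Hom D (fobj (src h) x) (fobj (src n) x)"
    "\<And>x. x \<in> Obj C \<Longrightarrow> cmpt h x = cmpt n x \<cdot>\<^bsub>D\<^esub> u x"
    by metis
  define \<upsilon> where "\<upsilon> = \<lparr>src = src h, trg = src n, cmpt = restrict u (Obj C)\<rparr>"
  have \<upsilon>: "is_nat_tr C D \<upsilon>"
    unfolding is_nat_tr_def
  proof (intro conjI allI ballI)
    fix x y f assume f: "f \<in> Hom C x y"
    have xy: "x \<in> Obj C" "y \<in> Obj C"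
      using C.Hom_obj[OF f] .
    note Hf = functor_arr[OF nat_tr_functor(1)[OF h(1)] f]
      and Nf = functor_arr[OF nat_tr_functor(1)[OF n] f]
      and Tf = functor_arr[OF nat_tr_functor(2)[OF h(1)] f]
    have "cmpt n y \<cdot>\<^bsub>D\<^esub> (u y \<cdot>\<^bsub>D\<^esub> farr (src h) f) = cmpt h y \<cdot>\<^bsub>D\<^esub> farr (src h) f"
      using D.cmp_assoc[OF Hf u(1)[OF xy(2)] nH[OF xy(2)]] u(2)[OF xy(2)] by simp
    also have "\<dots> = farr (trg n) f \<cdot>\<^bsub>D\<^esub> cmpt h x"
      using nat_tr_natural[OF h(1) f] h(2) by simp
    also have "\<dots> = (farr (trg n) f \<cdot>\<^bsub>D\<^esub> cmpt n x) \<cdot>\<^bsub>D\<^esub> u x"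
      using D.cmp_assoc[OF u(1)[OF xy(1)] nH[OF xy(1)] Tf] u(2)[OF xy(1)] h(2) by simp
    also have "\<dots> = (cmpt n y \<cdot>\<^bsub>D\<^esub> farr (src n) f) \<cdot>\<^bsub>D\<^esub> u x"
      using nat_tr_natural[OF n f] by simp
    also have "\<dots> = cmpt n y \<cdot>\<^bsub>D\<^esub> (farr (src n) f \<cdot>\<^bsub>D\<^esub> u x)"
      using D.cmp_assoc[OF u(1)[OF xy(1)] Nf nH[OF xy(2)]] by simp
    finally have "u y \<cdot>\<^bsub>D\<^esub> farr (src h) f = farr (src n) f \<cdot>\<^bsub>D\<^esub> u x"
      by (rule is_monoD[OF mono[OF xy(2)] nH[OF xy(2)] D.cmp_hom[OF Hf u(1)[OF xy(2)]]
            D.cmp_hom[OF u(1)[OF xy(1)] Nf]])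
    then show "cmpt \<upsilon> y \<cdot>\<^bsub>D\<^esub> farr (src \<upsilon>) f = farr (trg \<upsilon>) f \<cdot>\<^bsub>D\<^esub> cmpt \<upsilon> x"
      using xy by (simp add: \<upsilon>_def)
  qed (use n h u(1) in \<open>simp_all add: \<upsilon>_def is_nat_tr_def\<close>)
  have "n \<cdot>\<^bsub>Fun C D\<^esub> \<upsilon> = h"
    by (rule nat_tr_eqI[of C D]) (use nat_tr_cmp[OF \<upsilon> n] h u(2) in \<open>simp_all add: \<upsilon>_def\<close>)
  then show ?thesis
    using \<upsilon> by (intro factors_throughI[of \<upsilon>]) (simp_all add: Fun_Hom, simp_all add: \<upsilon>_def)
qed

text \<open>Dual to \<open>Fun_factors_throughI\<close>: the naturality square at \<open>f\<close>
  commutes after precomposition with \<open>cmpt n x\<close>, which is epi and can be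
  cancelled.\<close>

lemma Fun_factors_through_epi:
  assumes n: "is_nat_tr C D n" and epi: "\<And>x. x \<in> Obj C \<Longrightarrow> is_epi D (cmpt n x)"
    and h: "is_nat_tr C D h" "src h = src n"
    and ft: "\<And>x. x \<in> Obj C \<Longrightarrow>
      \<exists>u \<in> Hom D (fobj (trg n) x) (fobj (trg h) x). u \<cdot>\<^bsub>D\<^esub> cmpt n x = cmpt h x"
  shows "\<exists>\<upsilon> \<in> Hom (Fun C D) (trg n) (trg h). \<upsilon> \<cdot>\<^bsub>Fun C D\<^esub> n = h"
proof -
  note hH = nat_tr_cmpt[OF h(1)] and nH = nat_tr_cmpt[OF n, folded h(2)]
  obtain u where u: "\<And>x. x \<in> Obj C \<Longrightarrow> u x \<in> Hom D (fobj (trg n) x) (fobj (trg h) x)"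
    "\<And>x. x \<in> Obj C \<Longrightarrow> u x \<cdot>\<^bsub>D\<^esub> cmpt n x = cmpt h x"
    using ft by metis
  define \<upsilon> where "\<upsilon> = \<lparr>src = trg n, trg = trg h, cmpt = restrict u (Obj C)\<rparr>"
  have \<upsilon>: "is_nat_tr C D \<upsilon>"
    unfolding is_nat_tr_def
  proof (intro conjI allI ballI)
    fix x y f assume f: "f \<in> Hom C x y"
    have xy: "x \<in> Obj C" "y \<in> Obj C"
      using C.Hom_obj[OF f] .
    note Hf = functor_arr[OF nat_tr_functor(2)[OF h(1)] f]
      and Nf = functor_arr[OF nat_tr_functor(2)[OF n] f]
      and Tf = functor_arr[OF nat_tr_functor(1)[OF h(1)] f]
    have "(farr (trg h) f \<cdot>\<^bsub>D\<^esub> u x) \<cdot>\<^bsub>D\<^esub> cmpt n x = farr (trg h) f \<cdot>\<^bsub>D\<^esub> cmpt h x"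
      using D.cmp_assoc[OF nH[OF xy(1)] u(1)[OF xy(1)] Hf] u(2)[OF xy(1)] by simp
    also have "\<dots> = cmpt h y \<cdot>\<^bsub>D\<^esub> farr (src h) f"
      using nat_tr_natural[OF h(1) f] by simp
    also have "\<dots> = u y \<cdot>\<^bsub>D\<^esub> (cmpt n y \<cdot>\<^bsub>D\<^esub> farr (src n) f)"
      using D.cmp_assoc[OF Tf nH[OF xy(2)] u(1)[OF xy(2)]] u(2)[OF xy(2)] h(2) by simp
    also have "\<dots> = u y \<cdot>\<^bsub>D\<^esub> (farr (trg n) f \<cdot>\<^bsub>D\<^esub> cmpt n x)"
      using nat_tr_natural[OF n f] by simp
    also have "\<dots> = (u y \<cdot>\<^bsub>D\<^esub> farr (trg n) f) \<cdot>\<^bsub>D\<^esub> cmpt n x"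
      using D.cmp_assoc[OF nH[OF xy(1)] Nf u(1)[OF xy(2)]] by simp
    finally have "farr (trg h) f \<cdot>\<^bsub>D\<^esub> u x = u y \<cdot>\<^bsub>D\<^esub> farr (trg n) f"
      by (rule is_epiD[OF epi[OF xy(1)] nH[OF xy(1)] D.cmp_hom[OF u(1)[OF xy(1)] Hf]
            D.cmp_hom[OF Nf u(1)[OF xy(2)]]])
    then show "cmpt \<upsilon> y \<cdot>\<^bsub>D\<^esub> farr (src \<upsilon>) f = farr (trg \<upsilon>) f \<cdot>\<^bsub>D\<^esub> cmpt \<upsilon> x"
      using xy by (simp add: \<upsilon>_def)
  qed (use n h u(1) in \<open>simp_all add: \<upsilon>_def is_nat_tr_def\<close>)
  have "\<upsilon> \<cdot>\<^bsub>Fun C D\<^esub> n = h"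
    by (rule nat_tr_eqI[of C D]) (use nat_tr_cmp[OF n \<upsilon>] h u(2) in \<open>simp_all add: \<upsilon>_def\<close>)
  moreover have "\<upsilon> \<in> Hom (Fun C D) (trg n) (trg h)"
    using \<upsilon> by (simp add: Fun_Hom) (simp add: \<upsilon>_def)
  ultimately show ?thesis by blast
qed

text \<open>Only existence of the restricted arrows \<open>u\<close> is assumed. Because each
  \<open>k x\<close> is mono, they are unique, and uniqueness forces the chosen family to preserve
  identities and composites; the monomorphisms \<open>k x\<close> are then natural by
  construction.\<close>

lemma subfunctor_exists:
  assumes T: "is_functor C D T"
    and k: "\<And>x. x \<in> Obj C \<Longrightarrow> k x \<in> Hom D (d x) (fobj T x)"
    and mono: "\<And>x. x \<in> Obj C \<Longrightarrow> is_mono D (k x)"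
    and ft: "\<And>x y f. f \<in> Hom C x y \<Longrightarrow>
      \<exists>u \<in> Hom D (d x) (d y). k y \<cdot>\<^bsub>D\<^esub> u = farr T f \<cdot>\<^bsub>D\<^esub> k x"
  shows "\<exists>n. is_nat_tr C D n \<and> trg n = T \<and> (\<forall>x \<in> Obj C. cmpt n x = k x)"
proof -
  have "\<exists>u. u \<in> Hom D (d (Dom C f)) (d (Cod C f)) \<and>
      k (Cod C f) \<cdot>\<^bsub>D\<^esub> u = farr T f \<cdot>\<^bsub>D\<^esub> k (Dom C f)" if "f \<in> Arr C" for f
    using ft[OF Arr_Hom[OF that]] by blast
  then obtain u where u: "\<And>f. f \<in> Arr C \<Longrightarrow> u f \<in> Hom D (d (Dom C f)) (d (Cod C f)) \<and>
      k (Cod C f) \<cdot>\<^bsub>D\<^esub> u f = farr T f \<cdot>\<^bsub>D\<^esub> k (Dom C f)"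
    by metis
  have uH: "u f \<in> Hom D (d x) (d y)" "k y \<cdot>\<^bsub>D\<^esub> u f = farr T f \<cdot>\<^bsub>D\<^esub> k x" if "f \<in> Hom C x y" for f x y
    using u[of f] that by (auto simp: Hom_iff)
  have cancel: "a = b" if "x \<in> Obj C" "a \<in> Hom D w (d x)" "b \<in> Hom D w (d x)"
    "k x \<cdot>\<^bsub>D\<^esub> a = k x \<cdot>\<^bsub>D\<^esub> b" for a b w x
    using is_monoD[OF mono k] that by blast
  have u_ide: "u (Ide C x) = Ide D (d x)" if x: "x \<in> Obj C" for x
  proof (rule cancel[OF x])
    note i = C.ide_hom[OF x]
    show "u (Ide C x) \<in> Hom D (d x) (d x)" using uH[OF i] by blast
    show "Ide D (d x) \<in> Hom D (d x) (d x)" using D.ide_hom D.Hom_obj[OF k[OF x]] by blast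
    show "k x \<cdot>\<^bsub>D\<^esub> u (Ide C x) = k x \<cdot>\<^bsub>D\<^esub> Ide D (d x)"
      using uH(2)[OF i] functor_ide[OF T x] D.ide_cmp[OF k[OF x]] D.cmp_ide[OF k[OF x]] by simp
  qed
  have u_cmp: "u (g \<cdot>\<^bsub>C\<^esub> f) = u g \<cdot>\<^bsub>D\<^esub> u f" if f: "f \<in> Hom C x y" and g: "g \<in> Hom C y z" for f g x y z
  proof (rule cancel)
    note gf = C.cmp_hom[OF f g]
    note xyz = C.Hom_obj[OF f] C.Hom_obj(2)[OF g]
    show "z \<in> Obj C" using xyz by blast
    show "u (g \<cdot>\<^bsub>C\<^esub> f) \<in> Hom D (d x) (d z)" using uH[OF gf] by blast
    show "u g \<cdot>\<^bsub>D\<^esub> u f \<in> Hom D (d x) (d z)" using D.cmp_hom uH f g by blast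
    note Tf = functor_arr[OF T f] and Tg = functor_arr[OF T g]
    have "k z \<cdot>\<^bsub>D\<^esub> u (g \<cdot>\<^bsub>C\<^esub> f) = farr T g \<cdot>\<^bsub>D\<^esub> (farr T f \<cdot>\<^bsub>D\<^esub> k x)"
      using uH(2)[OF gf] functor_cmp[OF T f g] D.cmp_assoc[OF k[OF xyz(1)] Tf Tg] by simp
    also have "\<dots> = (farr T g \<cdot>\<^bsub>D\<^esub> k y) \<cdot>\<^bsub>D\<^esub> u f"
      using uH(2)[OF f] D.cmp_assoc[OF uH(1)[OF f] k[OF xyz(2)] Tg] by simp
    also have "\<dots> = k z \<cdot>\<^bsub>D\<^esub> (u g \<cdot>\<^bsub>D\<^esub> u f)"
      using uH(2)[OF g] D.cmp_assoc[OF uH(1)[OF f] uH(1)[OF g] k[OF xyz(3)]] by simp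
    finally show "k z \<cdot>\<^bsub>D\<^esub> u (g \<cdot>\<^bsub>C\<^esub> f) = k z \<cdot>\<^bsub>D\<^esub> (u g \<cdot>\<^bsub>D\<^esub> u f)" .
  qed
  define K where "K = \<lparr>fobj = restrict d (Obj C), farr = restrict u (Arr C)\<rparr>"
  have K: "is_functor C D K"
    unfolding is_functor_def
  proof (intro conjI allI ballI)
    show "fobj K \<in> Obj C \<rightarrow>\<^sub>E Obj D"
      using D.Hom_obj(1)[OF k] by (auto simp: K_def)
    show "farr K \<in> Arr C \<rightarrow>\<^sub>E Arr D"
      using u by (auto simp: K_def Hom_iff)
    show "farr K (Ide C x) = Ide D (fobj K x)" if "x \<in> Obj C" for x
      using that u_ide C.ide_hom[OF that] by (simp add: K_def Hom_iff)
    fix f x y assume f: "f \<in> Hom C x y"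
    show "farr K f \<in> Hom D (fobj K x) (fobj K y)"
      using uH(1)[OF f] f C.Hom_obj[OF f] by (simp add: K_def Hom_iff)
    fix g z assume g: "g \<in> Hom C y z"
    show "farr K (g \<cdot>\<^bsub>C\<^esub> f) = farr K g \<cdot>\<^bsub>D\<^esub> farr K f"
      using u_cmp[OF f g] C.cmp_hom[OF f g] f g by (simp add: K_def Hom_iff)
  qed
  define n where "n = \<lparr>src = K, trg = T, cmpt = restrict k (Obj C)\<rparr>"
  have "is_nat_tr C D n"
    unfolding is_nat_tr_def
  proof (intro conjI allI ballI)
    fix x y f assume f: "f \<in> Hom C x y"
    show "cmpt n y \<cdot>\<^bsub>D\<^esub> farr (src n) f = farr (trg n) f \<cdot>\<^bsub>D\<^esub> cmpt n x"
      using uH(2)[OF f] C.Hom_obj[OF f] f by (simp add: n_def K_def Hom_iff)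
  qed (use K T k in \<open>simp_all add: n_def, simp_all add: K_def\<close>)
  then show ?thesis by (intro exI[of _ n]) (simp add: n_def)
qed

text \<open>Dual to \<open>subfunctor_exists\<close>: the induced arrows on the quotients are unique
  because each \<open>k x\<close> is epi.\<close>

lemma quotient_functor_exists:
  assumes T: "is_functor C D T"
    and k: "\<And>x. x \<in> Obj C \<Longrightarrow> k x \<in> Hom D (fobj T x) (d x)"
    and epi: "\<And>x. x \<in> Obj C \<Longrightarrow> is_epi D (k x)"
    and ft: "\<And>x y f. f \<in> Hom C x y \<Longrightarrow>
      \<exists>u \<in> Hom D (d x) (d y). u \<cdot>\<^bsub>D\<^esub> k x = k y \<cdot>\<^bsub>D\<^esub> farr T f"
  shows "\<exists>n. is_nat_tr C D n \<and> src n = T \<and> (\<forall>x \<in> Obj C. cmpt n x = k x)"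
proof -
  have "\<exists>u. u \<in> Hom D (d (Dom C f)) (d (Cod C f)) \<and>
      u \<cdot>\<^bsub>D\<^esub> k (Dom C f) = k (Cod C f) \<cdot>\<^bsub>D\<^esub> farr T f" if "f \<in> Arr C" for f
    using ft[OF Arr_Hom[OF that]] by blast
  then obtain u where u: "\<And>f. f \<in> Arr C \<Longrightarrow> u f \<in> Hom D (d (Dom C f)) (d (Cod C f)) \<and>
      u f \<cdot>\<^bsub>D\<^esub> k (Dom C f) = k (Cod C f) \<cdot>\<^bsub>D\<^esub> farr T f"
    by metis
  have uH: "u f \<in> Hom D (d x) (d y)" "u f \<cdot>\<^bsub>D\<^esub> k x = k y \<cdot>\<^bsub>D\<^esub> farr T f" if "f \<in> Hom C x y" for f x y
    using u[of f] that by (auto simp: Hom_iff)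
  have cancel: "a = b" if "x \<in> Obj C" "a \<in> Hom D (d x) w" "b \<in> Hom D (d x) w"
    "a \<cdot>\<^bsub>D\<^esub> k x = b \<cdot>\<^bsub>D\<^esub> k x" for a b w x
    using is_epiD[OF epi k] that by blast
  have u_ide: "u (Ide C x) = Ide D (d x)" if x: "x \<in> Obj C" for x
  proof (rule cancel[OF x])
    note i = C.ide_hom[OF x]
    show "u (Ide C x) \<in> Hom D (d x) (d x)" using uH[OF i] by blast
    show "Ide D (d x) \<in> Hom D (d x) (d x)" using D.ide_hom D.Hom_obj[OF k[OF x]] by blast
    show "u (Ide C x) \<cdot>\<^bsub>D\<^esub> k x = Ide D (d x) \<cdot>\<^bsub>D\<^esub> k x"
      using uH(2)[OF i] functor_ide[OF T x] D.ide_cmp[OF k[OF x]] D.cmp_ide[OF k[OF x]] by simp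
  qed
  have u_cmp: "u (g \<cdot>\<^bsub>C\<^esub> f) = u g \<cdot>\<^bsub>D\<^esub> u f" if f: "f \<in> Hom C x y" and g: "g \<in> Hom C y z" for f g x y z
  proof (rule cancel)
    note gf = C.cmp_hom[OF f g]
    note xyz = C.Hom_obj[OF f] C.Hom_obj(2)[OF g]
    show "x \<in> Obj C" using xyz by blast
    show "u (g \<cdot>\<^bsub>C\<^esub> f) \<in> Hom D (d x) (d z)" using uH[OF gf] by blast
    show "u g \<cdot>\<^bsub>D\<^esub> u f \<in> Hom D (d x) (d z)" using D.cmp_hom uH f g by blast
    note Tf = functor_arr[OF T f] and Tg = functor_arr[OF T g]
    have "u (g \<cdot>\<^bsub>C\<^esub> f) \<cdot>\<^bsub>D\<^esub> k x = (k z \<cdot>\<^bsub>D\<^esub> farr T g) \<cdot>\<^bsub>D\<^esub> farr T f"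
      using uH(2)[OF gf] functor_cmp[OF T f g] D.cmp_assoc[OF Tf Tg k[OF xyz(3)]] by simp
    also have "\<dots> = u g \<cdot>\<^bsub>D\<^esub> (k y \<cdot>\<^bsub>D\<^esub> farr T f)"
      using uH(2)[OF g] D.cmp_assoc[OF Tf k[OF xyz(2)] uH(1)[OF g]] by simp
    also have "\<dots> = (u g \<cdot>\<^bsub>D\<^esub> u f) \<cdot>\<^bsub>D\<^esub> k x"
      using uH(2)[OF f] D.cmp_assoc[OF k[OF xyz(1)] uH(1)[OF f] uH(1)[OF g]] by simp
    finally show "u (g \<cdot>\<^bsub>C\<^esub> f) \<cdot>\<^bsub>D\<^esub> k x = (u g \<cdot>\<^bsub>D\<^esub> u f) \<cdot>\<^bsub>D\<^esub> k x" .
  qed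
  define K where "K = \<lparr>fobj = restrict d (Obj C), farr = restrict u (Arr C)\<rparr>"
  have K: "is_functor C D K"
    unfolding is_functor_def
  proof (intro conjI allI ballI)
    show "fobj K \<in> Obj C \<rightarrow>\<^sub>E Obj D"
      using D.Hom_obj(2)[OF k] by (auto simp: K_def)
    show "farr K \<in> Arr C \<rightarrow>\<^sub>E Arr D"
      using u by (auto simp: K_def Hom_iff)
    show "farr K (Ide C x) = Ide D (fobj K x)" if "x \<in> Obj C" for x
      using that u_ide C.ide_hom[OF that] by (simp add: K_def Hom_iff)
    fix f x y assume f: "f \<in> Hom C x y"
    show "farr K f \<in> Hom D (fobj K x) (fobj K y)"
      using uH(1)[OF f] f C.Hom_obj[OF f] by (simp add: K_def Hom_iff)
    fix g z assume g: "g \<in> Hom C y z"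
    show "farr K (g \<cdot>\<^bsub>C\<^esub> f) = farr K g \<cdot>\<^bsub>D\<^esub> farr K f"
      using u_cmp[OF f g] C.cmp_hom[OF f g] f g by (simp add: K_def Hom_iff)
  qed
  define n where "n = \<lparr>src = T, trg = K, cmpt = restrict k (Obj C)\<rparr>"
  have "is_nat_tr C D n"
    unfolding is_nat_tr_def
  proof (intro conjI allI ballI)
    fix x y f assume f: "f \<in> Hom C x y"
    show "cmpt n y \<cdot>\<^bsub>D\<^esub> farr (src n) f = farr (trg n) f \<cdot>\<^bsub>D\<^esub> cmpt n x"
      using uH(2)[OF f] C.Hom_obj[OF f] f by (simp add: n_def K_def Hom_iff)
  qed (use K T k in \<open>simp_all add: n_def, simp_all add: K_def\<close>)
  then show ?thesis by (intro exI[of _ n]) (simp add: n_def)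
qed

section \<open>Zero arrows, kernels and cokernels in functor categories\<close>

text \<open>The constant functor at \<open>z\<close> works: components into and out of
  \<open>z\<close> are unique, and the same uniqueness makes every family of them natural. Its
  values are recorded so that zero natural transformations can be compared with zero
  components.\<close>

lemma Fun_zero_obj_exists:
  assumes z: "is_zero_obj D z"
  shows "\<exists>Z. is_zero_obj (Fun C D) Z \<and> (\<forall>x \<in> Obj C. fobj Z x = z)"
proof -
  define Z where "Z = \<lparr>fobj = (\<lambda>x \<in> Obj C. z), farr = (\<lambda>f \<in> Arr C. Ide D z)\<rparr>"
  have zD: "z \<in> Obj D" using z by (simp add: is_zero_obj_def)
  note zz = D.ide_hom[OF zD]
  have unique: "f = g" if "f \<in> Hom D x z \<and> g \<in> Hom D x z \<or> f \<in> Hom D z x \<and> g \<in> Hom D z x" for f g x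
    using z that D.Hom_obj unfolding is_zero_obj_def by metis
  have ZI: "is_functor C D Z"
    unfolding is_functor_def
  proof (intro conjI allI ballI)
    show "farr Z (Ide C x) = Ide D (fobj Z x)" if "x \<in> Obj C" for x
      using that C.ide_hom[OF that] by (simp add: Z_def Hom_iff)
    fix f x y assume f: "f \<in> Hom C x y"
    show "farr Z f \<in> Hom D (fobj Z x) (fobj Z y)"
      using C.Hom_obj[OF f] f zz by (simp add: Z_def Hom_iff)
    fix g w assume g: "g \<in> Hom C y w"
    show "farr Z (g \<cdot>\<^bsub>C\<^esub> f) = farr Z g \<cdot>\<^bsub>D\<^esub> farr Z f"
      using C.cmp_hom[OF f g] f g D.cmp_ide[OF zz] by (simp add: Z_def Hom_iff)
  qed (use zz zD in \<open>auto simp: Z_def Hom_iff\<close>)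
  have "\<exists>!\<tau>. \<tau> \<in> Hom (Fun C D) F Z" if F: "is_functor C D F" for F
  proof (rule ex_ex1I)
    obtain a where a: "\<And>x. x \<in> Obj C \<Longrightarrow> a x \<in> Hom D (fobj F x) z"
      using zero_obj_arr(1)[OF z functor_obj[OF F]] by metis
    define \<tau> where "\<tau> = \<lparr>src = F, trg = Z, cmpt = restrict a (Obj C)\<rparr>"
    have "is_nat_tr C D \<tau>"
      unfolding is_nat_tr_def
    proof (intro conjI allI ballI)
      show "cmpt \<tau> x \<in> Hom D (fobj (src \<tau>) x) (fobj (trg \<tau>) x)" if "x \<in> Obj C" for x
        using that a by (simp add: \<tau>_def Z_def)
      fix x y f assume f: "f \<in> Hom C x y"
      note xy = C.Hom_obj[OF f]
      have "a y \<cdot>\<^bsub>D\<^esub> farr F f = Ide D z \<cdot>\<^bsub>D\<^esub> a x"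
        using D.cmp_hom[OF functor_arr[OF F f] a[OF xy(2)]] D.cmp_hom[OF a[OF xy(1)] zz] unique by blast
      then show "cmpt \<tau> y \<cdot>\<^bsub>D\<^esub> farr (src \<tau>) f = farr (trg \<tau>) f \<cdot>\<^bsub>D\<^esub> cmpt \<tau> x"
        using xy f by (simp add: \<tau>_def Z_def Hom_iff)
    qed (use F ZI in \<open>simp_all add: \<tau>_def\<close>)
    then show "\<exists>\<tau>. \<tau> \<in> Hom (Fun C D) F Z"
      by (intro exI[of _ \<tau>]) (simp add: Fun_Hom, simp add: \<tau>_def)
    fix \<sigma> \<tau> assume "\<sigma> \<in> Hom (Fun C D) F Z" "\<tau> \<in> Hom (Fun C D) F Z"
    then have st: "is_nat_tr C D \<sigma>" "src \<sigma> = F" "trg \<sigma> = Z" "is_nat_tr C D \<tau>" "src \<tau> = F" "trg \<tau> = Z"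
      by (auto simp: Fun_Hom)
    show "\<sigma> = \<tau>"
    proof (rule nat_tr_eqI[OF st(1,4)])
      fix x assume x: "x \<in> Obj C"
      then show "cmpt \<sigma> x = cmpt \<tau> x"
        using nat_tr_cmpt[OF st(1) x] nat_tr_cmpt[OF st(4) x] st unique[of "cmpt \<sigma> x" "fobj F x"]
        by (simp add: Z_def)
    qed (use st in simp_all)
  qed
  moreover have "\<exists>!\<tau>. \<tau> \<in> Hom (Fun C D) Z F" if F: "is_functor C D F" for F
  proof (rule ex_ex1I)
    obtain a where a: "\<And>x. x \<in> Obj C \<Longrightarrow> a x \<in> Hom D z (fobj F x)"
      using zero_obj_arr(2)[OF z functor_obj[OF F]] by metis
    define \<tau> where "\<tau> = \<lparr>src = Z, trg = F, cmpt = restrict a (Obj C)\<rparr>"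
    have "is_nat_tr C D \<tau>"
      unfolding is_nat_tr_def
    proof (intro conjI allI ballI)
      show "cmpt \<tau> x \<in> Hom D (fobj (src \<tau>) x) (fobj (trg \<tau>) x)" if "x \<in> Obj C" for x
        using that a by (simp add: \<tau>_def Z_def)
      fix x y f assume f: "f \<in> Hom C x y"
      note xy = C.Hom_obj[OF f]
      have "a y \<cdot>\<^bsub>D\<^esub> Ide D z = farr F f \<cdot>\<^bsub>D\<^esub> a x"
        using D.cmp_hom[OF a[OF xy(1)] functor_arr[OF F f]] D.cmp_hom[OF zz a[OF xy(2)]] unique by blast
      then show "cmpt \<tau> y \<cdot>\<^bsub>D\<^esub> farr (src \<tau>) f = farr (trg \<tau>) f \<cdot>\<^bsub>D\<^esub> cmpt \<tau> x"
        using xy f by (simp add: \<tau>_def Z_def Hom_iff)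
    qed (use F ZI in \<open>simp_all add: \<tau>_def\<close>)
    then show "\<exists>\<tau>. \<tau> \<in> Hom (Fun C D) Z F"
      by (intro exI[of _ \<tau>]) (simp add: Fun_Hom, simp add: \<tau>_def)
    fix \<sigma> \<tau> assume "\<sigma> \<in> Hom (Fun C D) Z F" "\<tau> \<in> Hom (Fun C D) Z F"
    then have st: "is_nat_tr C D \<sigma>" "src \<sigma> = Z" "trg \<sigma> = F" "is_nat_tr C D \<tau>" "src \<tau> = Z" "trg \<tau> = F"
      by (auto simp: Fun_Hom)
    show "\<sigma> = \<tau>"
    proof (rule nat_tr_eqI[OF st(1,4)])
      fix x assume x: "x \<in> Obj C"
      then show "cmpt \<sigma> x = cmpt \<tau> x"
        using nat_tr_cmpt[OF st(1) x] nat_tr_cmpt[OF st(4) x] st unique[of "cmpt \<sigma> x" "fobj F x"]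
        by (simp add: Z_def)
    qed (use st in simp_all)
  qed
  ultimately have "is_zero_obj (Fun C D) Z"
    using ZI by (simp add: is_zero_obj_def)
  moreover have "\<forall>x \<in> Obj C. fobj Z x = z"
    by (simp add: Z_def)
  ultimately show ?thesis by blast
qed

text \<open>Both sides are equivalent to the single equation
  \<open>\<tau> = \<beta> \<cdot> \<alpha>\<close>, where \<open>\<alpha>\<close> and
  \<open>\<beta>\<close> pass through a zero functor with constant value \<open>z\<close>. This
  avoids choosing a separate zero object for each component and gluing the choices.\<close>

lemma Fun_zero_arr_iff:
  assumes \<tau>: "is_nat_tr C D \<tau>"
  shows "is_zero_arr (Fun C D) \<tau> \<longleftrightarrow> (\<forall>x \<in> Obj C. is_zero_arr D (cmpt \<tau> x))"
proof -
  obtain z where z: "is_zero_obj D z" using D.zero_object by blast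
  obtain Z where Z: "is_zero_obj (Fun C D) Z" "\<And>x. x \<in> Obj C \<Longrightarrow> fobj Z x = z"
    using Fun_zero_obj_exists[OF z] by blast
  obtain \<alpha> \<beta> where "\<alpha> \<in> Hom (Fun C D) (src \<tau>) Z" "\<beta> \<in> Hom (Fun C D) Z (trg \<tau>)"
    using zero_obj_arr[OF Z(1)] nat_tr_functor[OF \<tau>] unfolding Fun_simps mem_Collect_eq by metis
  then have a: "is_nat_tr C D \<alpha>" "src \<alpha> = src \<tau>" "trg \<alpha> = Z"
    and b: "is_nat_tr C D \<beta>" "src \<beta> = Z" "trg \<beta> = trg \<tau>" by (auto simp: Fun_Hom)
  have aH: "cmpt \<alpha> x \<in> Hom D (fobj (src \<tau>) x) z" and bH: "cmpt \<beta> x \<in> Hom D z (fobj (trg \<tau>) x)"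
    if "x \<in> Obj C" for x
    using nat_tr_cmpt[OF a(1) that] nat_tr_cmpt[OF b(1) that] a b Z(2)[OF that] by auto
  note ba = nat_tr_cmp[OF a(1) b(1)]
  show ?thesis
  proof
    assume "is_zero_arr (Fun C D) \<tau>"
    then have t: "\<tau> = \<beta> \<cdot>\<^bsub>Fun C D\<^esub> \<alpha>"
      using Fun.zero_arr_through[of \<tau> "src \<tau>" "trg \<tau>" Z \<alpha> \<beta>] \<tau> Z a b by (simp add: Fun_Hom)
    show "\<forall>x \<in> Obj C. is_zero_arr D (cmpt \<tau> x)"
    proof
      fix x assume x: "x \<in> Obj C"
      then have "cmpt \<tau> x = cmpt \<beta> x \<cdot>\<^bsub>D\<^esub> cmpt \<alpha> x"
        using arg_cong[OF t, of "\<lambda>\<tau>. cmpt \<tau> x"] by simp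
      then show "is_zero_arr D (cmpt \<tau> x)"
        using nat_tr_cmpt[OF \<tau> x] aH[OF x] bH[OF x] z unfolding is_zero_arr_def Hom_iff by auto
    qed
  next
    assume zero: "\<forall>x \<in> Obj C. is_zero_arr D (cmpt \<tau> x)"
    have "\<tau> = \<beta> \<cdot>\<^bsub>Fun C D\<^esub> \<alpha>"
    proof (rule nat_tr_eqI[OF \<tau> ba])
      fix x assume x: "x \<in> Obj C"
      then show "cmpt \<tau> x = cmpt (\<beta> \<cdot>\<^bsub>Fun C D\<^esub> \<alpha>) x"
        using D.zero_arr_through[OF _ nat_tr_cmpt[OF \<tau> x] z aH[OF x] bH[OF x]] zero by simp
    qed (use a b in simp_all)
    then show "is_zero_arr (Fun C D) \<tau>"
      using \<tau> Z(1) a b unfolding is_zero_arr_def by (auto simp: Fun_Hom)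
  qed
qed

text \<open>Vanishing of a composite is tested on components, where the given kernels supply
  liftings; these are natural because kernels are mono.\<close>

lemma Fun_kernelI:
  assumes f: "is_nat_tr C D f" and k: "is_nat_tr C D k" "trg k = src f"
    and ker: "\<And>x. x \<in> Obj C \<Longrightarrow> is_kernel D (cmpt k x) (cmpt f x)"
  shows "is_kernel (Fun C D) k f"
proof (rule is_kernelI)
  show fH: "f \<in> Hom (Fun C D) (src f) (trg f)" and kH: "k \<in> Hom (Fun C D) (src k) (src f)"
    using f k by (auto simp: Fun_Hom)
  have mono: "is_mono D (cmpt k x)" if "x \<in> Obj C" for x
    using D.kernel_mono[OF ker[OF that]] .
  then show "is_mono (Fun C D) k"
    using Fun_monoI k(1) by blast
  show "is_zero_arr (Fun C D) (f \<cdot>\<^bsub>Fun C D\<^esub> k)"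
    using Fun_zero_arr_iff[OF nat_tr_cmp[OF k(1) f k(2)]] ker by (simp add: is_kernel_def)
  fix W h assume "h \<in> Hom (Fun C D) W (src f)" and zero: "is_zero_arr (Fun C D) (f \<cdot>\<^bsub>Fun C D\<^esub> h)"
  then have h: "is_nat_tr C D h" "src h = W" "trg h = src f" by (auto simp: Fun_Hom)
  have "factors_through (Fun C D) h k"
  proof (rule Fun_factors_throughI[OF k(1) mono h(1)])
    show "trg h = trg k" using h k by simp
    fix x assume x: "x \<in> Obj C"
    have "is_zero_arr D (cmpt f x \<cdot>\<^bsub>D\<^esub> cmpt h x)"
      using Fun_zero_arr_iff[OF nat_tr_cmp[OF h(1) f h(3)]] zero x by simp
    then show "factors_through D (cmpt h x) (cmpt k x)"
      using is_kernelD[OF ker[OF x], of "cmpt h x" "fobj (src h) x"] nat_tr_cmpt[OF h(1) x]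
        nat_tr_cmpt[OF f x] h(3) by (auto simp: Hom_iff intro: factors_throughI)
  qed
  then show "\<exists>u \<in> Hom (Fun C D) W (src k). k \<cdot>\<^bsub>Fun C D\<^esub> u = h"
    using h unfolding factors_through_def by auto
qed

lemma Fun_cokernelI:
  assumes f: "is_nat_tr C D f" and k: "is_nat_tr C D k" "src k = trg f"
    and coker: "\<And>x. x \<in> Obj C \<Longrightarrow> is_cokernel D (cmpt k x) (cmpt f x)"
  shows "is_cokernel (Fun C D) k f"
proof (rule is_cokernelI)
  show fH: "f \<in> Hom (Fun C D) (src f) (trg f)" and kH: "k \<in> Hom (Fun C D) (trg f) (trg k)"
    using f k by (auto simp: Fun_Hom)
  have epi: "is_epi D (cmpt k x)" if "x \<in> Obj C" for x
    using D.cokernel_epi[OF coker[OF that]] .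
  then show "is_epi (Fun C D) k"
    using Fun_epiI k(1) by blast
  show "is_zero_arr (Fun C D) (k \<cdot>\<^bsub>Fun C D\<^esub> f)"
    using Fun_zero_arr_iff[OF nat_tr_cmp[OF f k(1)]] k(2) coker by (simp add: is_cokernel_def)
  fix W h assume "h \<in> Hom (Fun C D) (trg f) W" and zero: "is_zero_arr (Fun C D) (h \<cdot>\<^bsub>Fun C D\<^esub> f)"
  then have h: "is_nat_tr C D h" "src h = trg f" "trg h = W" by (auto simp: Fun_Hom)
  have "\<exists>\<upsilon> \<in> Hom (Fun C D) (trg k) (trg h). \<upsilon> \<cdot>\<^bsub>Fun C D\<^esub> k = h"
  proof (rule Fun_factors_through_epi[OF k(1) epi h(1)])
    show "src h = src k" using h k by simp
    fix x assume x: "x \<in> Obj C"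
    have "is_zero_arr D (cmpt h x \<cdot>\<^bsub>D\<^esub> cmpt f x)"
      using Fun_zero_arr_iff[OF nat_tr_cmp[OF f h(1) h(2)[symmetric]]] zero x by simp
    moreover have "cmpt h x \<in> Hom D (Cod D (cmpt f x)) (fobj (trg h) x)"
      using nat_tr_cmpt[OF h(1) x] nat_tr_cmpt[OF f x] h(2) by (simp add: Hom_iff)
    moreover have "Cod D (cmpt k x) = fobj (trg k) x"
      using nat_tr_cmpt[OF k(1) x] by (simp add: Hom_iff)
    ultimately show "\<exists>u \<in> Hom D (fobj (trg k) x) (fobj (trg h) x). u \<cdot>\<^bsub>D\<^esub> cmpt k x = cmpt h x"
      using is_cokernelD[OF coker[OF x], of "cmpt h x" "fobj (trg h) x"] by simp
  qed
  then show "\<exists>u \<in> Hom (Fun C D) (trg k) W. u \<cdot>\<^bsub>Fun C D\<^esub> k = h"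
    using h by simp
qed

lemma Fun_kernel_exists:
  assumes f: "is_nat_tr C D f"
  shows "\<exists>k. is_nat_tr C D k \<and> trg k = src f \<and> (\<forall>x \<in> Obj C. is_kernel D (cmpt k x) (cmpt f x))"
proof -
  have "\<exists>k. is_kernel D k (cmpt f x)" if "x \<in> Obj C" for x
    using D.kernels nat_tr_cmpt[OF f that] by (simp add: Hom_iff)
  then obtain k where k: "\<And>x. x \<in> Obj C \<Longrightarrow> is_kernel D (k x) (cmpt f x)"
    by metis
  have kH: "k x \<in> Hom D (Dom D (k x)) (fobj (src f) x)" if "x \<in> Obj C" for x
    using k[OF that] nat_tr_cmpt[OF f that] by (auto simp: is_kernel_def Hom_iff)
  have "\<exists>n. is_nat_tr C D n \<and> trg n = src f \<and> (\<forall>x \<in> Obj C. cmpt n x = k x)"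
  proof (rule subfunctor_exists[OF nat_tr_functor(1)[OF f] kH])
    show "is_mono D (k x)" if "x \<in> Obj C" for x
      using D.kernel_mono k that by blast
    fix x y g assume g: "g \<in> Hom C x y"
    note xy = C.Hom_obj[OF g]
    note Sg = functor_arr[OF nat_tr_functor(1)[OF f] g] and Tg = functor_arr[OF nat_tr_functor(2)[OF f] g]
    note fx = nat_tr_cmpt[OF f xy(1)] and fy = nat_tr_cmpt[OF f xy(2)]
    \<comment> \<open>By naturality \<open>f\<close> annihilates the image of the kernel at
      \<open>x\<close> under the source functor. So that functor carries the kernel at
      \<open>x\<close> into the kernel at \<open>y\<close>, as \<open>subfunctor_exists\<close>
      requires.\<close>
    have "cmpt f y \<cdot>\<^bsub>D\<^esub> (farr (src f) g \<cdot>\<^bsub>D\<^esub> k x) = farr (trg f) g \<cdot>\<^bsub>D\<^esub> (cmpt f x \<cdot>\<^bsub>D\<^esub> k x)"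
      using D.cmp_assoc[OF kH[OF xy(1)] Sg fy] nat_tr_natural[OF f g] D.cmp_assoc[OF kH[OF xy(1)] fx Tg]
      by simp
    moreover have "is_zero_arr D (cmpt f x \<cdot>\<^bsub>D\<^esub> k x)"
      using k[OF xy(1)] by (simp add: is_kernel_def)
    ultimately have "is_zero_arr D (cmpt f y \<cdot>\<^bsub>D\<^esub> (farr (src f) g \<cdot>\<^bsub>D\<^esub> k x))"
      using D.zero_arr_cmp_left[OF _ D.cmp_hom[OF kH[OF xy(1)] fx] Tg] by simp
    moreover have "farr (src f) g \<cdot>\<^bsub>D\<^esub> k x \<in> Hom D (Dom D (k x)) (Dom D (cmpt f y))"
      using D.cmp_hom[OF kH[OF xy(1)] Sg] fy by (simp add: Hom_iff)
    ultimately show "\<exists>u \<in> Hom D (Dom D (k x)) (Dom D (k y)). k y \<cdot>\<^bsub>D\<^esub> u = farr (src f) g \<cdot>\<^bsub>D\<^esub> k x"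
      using is_kernelD[OF k[OF xy(2)]] by blast
  qed
  then show ?thesis using k by metis
qed

lemma Fun_cokernel_exists:
  assumes f: "is_nat_tr C D f"
  shows "\<exists>k. is_nat_tr C D k \<and> src k = trg f \<and> (\<forall>x \<in> Obj C. is_cokernel D (cmpt k x) (cmpt f x))"
proof -
  have "\<exists>k. is_cokernel D k (cmpt f x)" if "x \<in> Obj C" for x
    using D.cokernels nat_tr_cmpt[OF f that] by (simp add: Hom_iff)
  then obtain k where k: "\<And>x. x \<in> Obj C \<Longrightarrow> is_cokernel D (k x) (cmpt f x)"
    by metis
  have kH: "k x \<in> Hom D (fobj (trg f) x) (Cod D (k x))" if "x \<in> Obj C" for x
    using k[OF that] nat_tr_cmpt[OF f that] by (auto simp: is_cokernel_def Hom_iff)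
  have "\<exists>n. is_nat_tr C D n \<and> src n = trg f \<and> (\<forall>x \<in> Obj C. cmpt n x = k x)"
  proof (rule quotient_functor_exists[OF nat_tr_functor(2)[OF f] kH])
    show "is_epi D (k x)" if "x \<in> Obj C" for x
      using D.cokernel_epi k that by blast
    fix x y g assume g: "g \<in> Hom C x y"
    note xy = C.Hom_obj[OF g]
    note Sg = functor_arr[OF nat_tr_functor(1)[OF f] g] and Tg = functor_arr[OF nat_tr_functor(2)[OF f] g]
    note fx = nat_tr_cmpt[OF f xy(1)] and fy = nat_tr_cmpt[OF f xy(2)]
    \<comment> \<open>Dually, naturality shows that the composite with the cokernel at
      \<open>y\<close> annihilates \<open>cmpt f x\<close>, so it descends to the cokernel at
      \<open>x\<close>.\<close>
    have "(k y \<cdot>\<^bsub>D\<^esub> farr (trg f) g) \<cdot>\<^bsub>D\<^esub> cmpt f x = (k y \<cdot>\<^bsub>D\<^esub> cmpt f y) \<cdot>\<^bsub>D\<^esub> farr (src f) g"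
      using D.cmp_assoc[OF fx Tg kH[OF xy(2)]] nat_tr_natural[OF f g] D.cmp_assoc[OF Sg fy kH[OF xy(2)]]
      by simp
    moreover have "is_zero_arr D (k y \<cdot>\<^bsub>D\<^esub> cmpt f y)"
      using k[OF xy(2)] by (simp add: is_cokernel_def)
    ultimately have "is_zero_arr D ((k y \<cdot>\<^bsub>D\<^esub> farr (trg f) g) \<cdot>\<^bsub>D\<^esub> cmpt f x)"
      using D.zero_arr_cmp_right[OF _ D.cmp_hom[OF fy kH[OF xy(2)]] Sg] by simp
    moreover have "k y \<cdot>\<^bsub>D\<^esub> farr (trg f) g \<in> Hom D (Cod D (cmpt f x)) (Cod D (k y))"
      using D.cmp_hom[OF Tg kH[OF xy(2)]] fx by (simp add: Hom_iff)
    ultimately show "\<exists>u \<in> Hom D (Cod D (k x)) (Cod D (k y)). u \<cdot>\<^bsub>D\<^esub> k x = k y \<cdot>\<^bsub>D\<^esub> farr (trg f) g"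
      using is_cokernelD[OF k[OF xy(1)]] by blast
  qed
  then show ?thesis using k by metis
qed

section \<open>Monomorphisms in functor categories\<close>

text \<open>The converse of \<open>Fun_monoI\<close>, and the harder direction. The detour through a
  kernel works because a kernel in \<open>Fun C D\<close> can be chosen with prescribed components:
  its vanishing as a natural transformation yields the vanishing of the kernel of each
  component.\<close>

lemma Fun_mono_cmpt:
  assumes mono: "is_mono (Fun C D) n" and x: "x \<in> Obj C"
  shows "is_mono D (cmpt n x)"
proof -
  have n: "is_nat_tr C D n" using mono by (simp add: is_mono_def)
  obtain k where k: "is_nat_tr C D k" "trg k = src n" "\<And>x. x \<in> Obj C \<Longrightarrow> is_kernel D (cmpt k x) (cmpt n x)"
    using Fun_kernel_exists[OF n] by blast
  note ker = Fun_kernelI[OF n k]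
  have nH: "n \<in> Hom (Fun C D) (src n) (trg n)" and kH: "k \<in> Hom (Fun C D) (src k) (src n)"
    using n k by (auto simp: Fun_Hom)
  obtain z where "is_zero_obj D z" using D.zero_object by blast
  then obtain Z where Z: "is_zero_obj (Fun C D) Z"
    using Fun_zero_obj_exists by blast
  obtain e where e: "e \<in> Hom (Fun C D) (src k) (src n)" "is_zero_arr (Fun C D) e"
    using Fun.zero_arr_exists[OF Z Fun.Hom_obj[OF kH]] by blast
  \<comment> \<open>\<open>e\<close> is a zero arrow parallel to \<open>k\<close>, so both
    composites are zero arrows between the same functors; cancelling \<open>n\<close> then gives
    \<open>k = e\<close>.\<close>
  have "n \<cdot>\<^bsub>Fun C D\<^esub> k = n \<cdot>\<^bsub>Fun C D\<^esub> e"
  proof (rule Fun.zero_arr_unique)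
    show "is_zero_arr (Fun C D) (n \<cdot>\<^bsub>Fun C D\<^esub> k)" using ker by (simp add: is_kernel_def)
    show "is_zero_arr (Fun C D) (n \<cdot>\<^bsub>Fun C D\<^esub> e)" using Fun.zero_arr_cmp_left[OF e(2,1) nH] .
  qed (use Fun.cmp_hom kH e nH in blast)+
  then have "k = e"
    using is_monoD[OF mono nH kH e(1)] by blast
  then have "is_zero_arr D (cmpt k x)"
    using e(2) Fun_zero_arr_iff[OF k(1)] x by blast
  then show ?thesis
    using D.mono_if_zero_kernel k(3)[OF x] by blast
qed

lemma Fun_factors_through_iff:
  assumes mono: "is_mono (Fun C D) n" and h: "is_nat_tr C D h" "trg h = trg n"
  shows "factors_through (Fun C D) h n \<longleftrightarrow>
    (\<forall>x \<in> Obj C. factors_through D (cmpt h x) (cmpt n x))"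
proof
  have n: "is_nat_tr C D n" using mono by (simp add: is_mono_def)
  show "factors_through (Fun C D) h n"
    if "\<forall>x \<in> Obj C. factors_through D (cmpt h x) (cmpt n x)"
    using Fun_factors_throughI[OF n Fun_mono_cmpt[OF mono] h] that by blast
  assume "factors_through (Fun C D) h n"
  then obtain u where u: "is_nat_tr C D u" "src u = src h" "trg u = src n" "h = n \<cdot>\<^bsub>Fun C D\<^esub> u"
    by (auto simp: factors_through_def Fun_Hom)
  show "\<forall>x \<in> Obj C. factors_through D (cmpt h x) (cmpt n x)"
  proof
    fix x assume x: "x \<in> Obj C"
    have "cmpt n x \<cdot>\<^bsub>D\<^esub> cmpt u x = cmpt h x"
      using arg_cong[OF u(4), of "\<lambda>\<tau>. cmpt \<tau> x"] x by simp
    then show "factors_through D (cmpt h x) (cmpt n x)"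
      using nat_tr_cmpt[OF u(1) x] nat_tr_cmpt[OF h(1) x] nat_tr_cmpt[OF n x] u(2,3)
      by (intro factors_throughI[of "cmpt u x"]) (auto simp: Hom_iff)
  qed
qed

sublocale Fun: normal_category "Fun C D"
proof
  fix f assume "f \<in> Arr (Fun C D)"
  then have f: "is_nat_tr C D f" by simp
  show "\<exists>k. is_kernel (Fun C D) k f"
    using Fun_kernel_exists[OF f] Fun_kernelI[OF f] by blast
  show "\<exists>c. is_cokernel (Fun C D) c f"
    using Fun_cokernel_exists[OF f] Fun_cokernelI[OF f] by blast
next
  fix m assume m: "is_mono (Fun C D) m"
  then have mt: "is_nat_tr C D m" by (simp add: is_mono_def)
  obtain c where c: "is_nat_tr C D c" "src c = trg m" "\<And>x. x \<in> Obj C \<Longrightarrow> is_cokernel D (cmpt c x) (cmpt m x)"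
    using Fun_cokernel_exists[OF mt] by blast
  \<comment> \<open>Each component of \<open>m\<close> is mono, hence the kernel of its cokernel,
    and the components of \<open>c\<close> are precisely such cokernels.\<close>
  have "is_kernel (Fun C D) m c"
    using Fun_kernelI[OF c(1) mt] c(2) D.normal.mono_kernel_of_cokernel[OF Fun_mono_cmpt[OF m] c(3)] by simp
  then show "\<exists>f. is_kernel (Fun C D) m f" by blast
qed

end

section \<open>Composite functors and whiskering\<close>

lemma comp_functor_is_functor:
  assumes C: "category C" and F: "is_functor C D F" and G: "is_functor D E G"
  shows "is_functor C E (comp_functor C G F)"
proof -
  interpret category C by fact
  show ?thesis
    unfolding is_functor_def
  proof (intro conjI allI ballI)
    show "fobj (comp_functor C G F) \<in> Obj C \<rightarrow>\<^sub>E Obj E"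
      using functor_obj[OF G functor_obj[OF F]] by (auto simp: comp_functor_def)
    show "farr (comp_functor C G F) \<in> Arr C \<rightarrow>\<^sub>E Arr E"
      using functor_arr[OF G functor_arr[OF F Arr_Hom]] by (auto simp: comp_functor_def Hom_iff)
    show "farr (comp_functor C G F) (Ide C x) = Ide E (fobj (comp_functor C G F) x)" if "x \<in> Obj C" for x
      using that ide_hom[OF that] functor_ide[OF F that] functor_ide[OF G functor_obj[OF F that]]
      by (simp add: comp_functor_def Hom_iff)
    fix f x y assume f: "f \<in> Hom C x y"
    show "farr (comp_functor C G F) f \<in> Hom E (fobj (comp_functor C G F) x) (fobj (comp_functor C G F) y)"
      using functor_arr[OF G functor_arr[OF F f]] Hom_obj[OF f] f by (simp add: comp_functor_def Hom_iff)
    fix g z assume g: "g \<in> Hom C y z"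
    show "farr (comp_functor C G F) (g \<cdot>\<^bsub>C\<^esub> f) = farr (comp_functor C G F) g \<cdot>\<^bsub>E\<^esub> farr (comp_functor C G F) f"
      using functor_cmp[OF F f g] functor_cmp[OF G functor_arr[OF F f] functor_arr[OF F g]] cmp_hom[OF f g] f g
      by (simp add: comp_functor_def Hom_iff)
  qed
qed

text \<open>This is a true equality thanks to extensionality. It makes the target of
  \<open>whisker B F \<tau> G\<close> literally the source of the counit, and the target of
  \<open>whisker A G \<sigma> F\<close> that of the unit.\<close>

lemma comp_id_functor:
  assumes F: "is_functor C D F"
  shows "comp_functor C (id_functor D) F = F"
proof -
  have "fobj (comp_functor C (id_functor D) F) = fobj F" "farr (comp_functor C (id_functor D) F) = farr F"
    using F by (auto simp: is_functor_def comp_functor_def id_functor_def fun_eq_iff PiE_def extensional_def Pi_iff)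
  then show ?thesis by simp
qed

lemma whisker_nat_tr:
  assumes B: "category B" and K: "is_functor B C K" and \<tau>: "is_nat_tr C D \<tau>" and H: "is_functor D E H"
  shows "is_nat_tr B E (whisker B H \<tau> K)"
proof -
  interpret category B by fact
  note S = nat_tr_functor(1)[OF \<tau>] and T = nat_tr_functor(2)[OF \<tau>]
  show ?thesis
    unfolding is_nat_tr_def
  proof (intro conjI allI ballI)
    show "is_functor B E (src (whisker B H \<tau> K))" "is_functor B E (trg (whisker B H \<tau> K))"
      using comp_functor_is_functor[OF B comp_functor_is_functor[OF B K S] H]
        comp_functor_is_functor[OF B comp_functor_is_functor[OF B K T] H]
      by (simp_all add: whisker_def)
    show "cmpt (whisker B H \<tau> K) \<in> extensional (Obj B)"
      by (simp add: whisker_def)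
    show "cmpt (whisker B H \<tau> K) x \<in> Hom E (fobj (src (whisker B H \<tau> K)) x) (fobj (trg (whisker B H \<tau> K)) x)"
      if "x \<in> Obj B" for x
      using functor_arr[OF H nat_tr_cmpt[OF \<tau> functor_obj[OF K that]]] that
      by (simp add: whisker_def comp_functor_def)
    fix x y f assume f: "f \<in> Hom B x y"
    note Kf = functor_arr[OF K f] and xy = Hom_obj[OF f]
    note tx = nat_tr_cmpt[OF \<tau> functor_obj[OF K xy(1)]] and ty = nat_tr_cmpt[OF \<tau> functor_obj[OF K xy(2)]]
    show "cmpt (whisker B H \<tau> K) y \<cdot>\<^bsub>E\<^esub> farr (src (whisker B H \<tau> K)) f =
      farr (trg (whisker B H \<tau> K)) f \<cdot>\<^bsub>E\<^esub> cmpt (whisker B H \<tau> K) x"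
      using functor_cmp[OF H functor_arr[OF S Kf] ty] functor_cmp[OF H tx functor_arr[OF T Kf]]
        nat_tr_natural[OF \<tau> Kf] xy f
      by (simp add: whisker_def comp_functor_def Hom_iff)
  qed
qed

section \<open>Preradicals and adjoint pairs\<close>

lemma preradical_cmpt:
  assumes "is_nat_tr C C \<tau>" "trg \<tau> = id_functor C" "x \<in> Obj C"
  shows "cmpt \<tau> x \<in> Hom C (fobj (src \<tau>) x) x"
  using nat_tr_cmpt[OF assms(1,3)] assms(2,3) by (simp add: id_functor_def)

lemma preradical_natural:
  assumes "is_nat_tr C C \<tau>" "trg \<tau> = id_functor C" "f \<in> Hom C x y"
  shows "cmpt \<tau> y \<cdot>\<^bsub>C\<^esub> farr (src \<tau>) f = f \<cdot>\<^bsub>C\<^esub> cmpt \<tau> x"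
  using nat_tr_natural[OF assms(1,3)] assms(2,3) by (simp add: id_functor_def Hom_iff)

lemma Pr_elem:
  assumes "P \<in> carrier (Pr C)" "\<tau> \<in> P" "category (Fun C C)"
  shows "is_mono (Fun C C) \<tau>" "is_nat_tr C C \<tau>" "trg \<tau> = id_functor C"
  using category.Sub_elem_mono[OF assms(3) assms(1)[unfolded Pr_def] assms(2)] by (auto simp: is_mono_def)

locale adjunction = A: abelian_category A + B: abelian_category B
  for A :: "('a, 'm) category" and B :: "('b, 'n) category" +
  fixes F :: "('a, 'm, 'b, 'n) fnctr" and G :: "('b, 'n, 'a, 'm) fnctr"
    and \<eta> :: "('a, 'm, 'a, 'm) nat_tr" and \<epsilon> :: "('b, 'n, 'b, 'n) nat_tr"
  assumes adj: "adjoint_pair A B F G \<eta> \<epsilon>"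
begin

sublocale AA: functor_category A A ..
sublocale BB: functor_category B B ..

section \<open>Transposition along the adjunction\<close>

lemma F: "is_functor A B F" and G: "is_functor B A G"
  using adj by (auto simp: adjoint_pair_def)

lemma unit: "is_nat_tr A A \<eta>" "src \<eta> = id_functor A" "trg \<eta> = comp_functor A G F"
  and counit: "is_nat_tr B B \<epsilon>" "src \<epsilon> = comp_functor B F G" "trg \<epsilon> = id_functor B"
  using adj by (auto simp: adjoint_pair_def Fun_Hom)

lemma unit_cmpt: "x \<in> Obj A \<Longrightarrow> cmpt \<eta> x \<in> Hom A x (fobj G (fobj F x))"
  using nat_tr_cmpt[OF unit(1)] by (simp add: unit id_functor_def comp_functor_def)

lemma counit_cmpt: "y \<in> Obj B \<Longrightarrow> cmpt \<epsilon> y \<in> Hom B (fobj F (fobj G y)) y"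
  using nat_tr_cmpt[OF counit(1)] by (simp add: counit id_functor_def comp_functor_def)

lemma unit_natural:
  "f \<in> Hom A x y \<Longrightarrow> cmpt \<eta> y \<cdot>\<^bsub>A\<^esub> f = farr G (farr F f) \<cdot>\<^bsub>A\<^esub> cmpt \<eta> x"
  using nat_tr_natural[OF unit(1), of f x y] by (simp add: unit id_functor_def comp_functor_def Hom_iff)

lemma counit_natural:
  "f \<in> Hom B x y \<Longrightarrow> cmpt \<epsilon> y \<cdot>\<^bsub>B\<^esub> farr F (farr G f) = f \<cdot>\<^bsub>B\<^esub> cmpt \<epsilon> x"
  using nat_tr_natural[OF counit(1), of f x y] by (simp add: counit id_functor_def comp_functor_def Hom_iff)

lemma triangle_F: "x \<in> Obj A \<Longrightarrow> cmpt \<epsilon> (fobj F x) \<cdot>\<^bsub>B\<^esub> farr F (cmpt \<eta> x) = Ide B (fobj F x)"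
  and triangle_G: "y \<in> Obj B \<Longrightarrow> farr G (cmpt \<epsilon> y) \<cdot>\<^bsub>A\<^esub> cmpt \<eta> (fobj G y) = Ide A (fobj G y)"
  using adj by (auto simp: adjoint_pair_def)

text \<open>One direction of the adjunction bijection between arrows
  \<open>F x \<rightarrow> y\<close> and \<open>x \<rightarrow> G y\<close>. The object is an
  argument because \<open>fobj F x\<close> does not determine \<open>x\<close>.\<close>

definition transpose :: "'a \<Rightarrow> 'n \<Rightarrow> 'm" where
  "transpose x f = farr G f \<cdot>\<^bsub>A\<^esub> cmpt \<eta> x"

text \<open>The opposite direction; here \<open>fobj G y\<close> does not determine
  \<open>y\<close>. With \<open>g = cmpt \<tau> (fobj G y)\<close> it is the component at
  \<open>y\<close> of the arrow whose image defines \<open>induced_lower\<close>.\<close>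

definition cotranspose :: "'b \<Rightarrow> 'm \<Rightarrow> 'n" where
  "cotranspose y g = cmpt \<epsilon> y \<cdot>\<^bsub>B\<^esub> farr F g"

lemma transpose_hom:
  assumes "x \<in> Obj A" "f \<in> Hom B (fobj F x) y"
  shows "transpose x f \<in> Hom A x (fobj G y)"
  unfolding transpose_def using A.cmp_hom[OF unit_cmpt functor_arr[OF G]] assms by blast

lemma cotranspose_hom:
  assumes "y \<in> Obj B" "g \<in> Hom A x (fobj G y)"
  shows "cotranspose y g \<in> Hom B (fobj F x) y"
  unfolding cotranspose_def using B.cmp_hom[OF functor_arr[OF F] counit_cmpt] assms by blast

lemma transpose_cmp:
  assumes "x \<in> Obj A" "f \<in> Hom B (fobj F x) y" "g \<in> Hom B y z"
  shows "transpose x (g \<cdot>\<^bsub>B\<^esub> f) = farr G g \<cdot>\<^bsub>A\<^esub> transpose x f"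
  unfolding transpose_def
  using functor_cmp[OF G assms(2,3)]
    A.cmp_assoc[OF unit_cmpt[OF assms(1)] functor_arr[OF G assms(2)] functor_arr[OF G assms(3)]] by simp

text \<open>Naturality of the adjunction bijection in its target, obtained from naturality of the
  counit at \<open>h\<close>.\<close>

lemma cotranspose_cmp:
  assumes g: "g \<in> Hom A x (fobj G y)" and h: "h \<in> Hom B y z"
  shows "cotranspose z (farr G h \<cdot>\<^bsub>A\<^esub> g) = h \<cdot>\<^bsub>B\<^esub> cotranspose y g"
proof -
  note yz = B.Hom_obj[OF h]
  note Gh = functor_arr[OF G h]
  show ?thesis
    unfolding cotranspose_def
    using functor_cmp[OF F g Gh] counit_natural[OF h]
      B.cmp_assoc[OF functor_arr[OF F g] functor_arr[OF F Gh] counit_cmpt[OF yz(2)]]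
      B.cmp_assoc[OF functor_arr[OF F g] counit_cmpt[OF yz(1)] h] by simp
qed

text \<open>Naturality of the unit moves \<open>g\<close> to the right end of the composite; what
  stands before it is the triangle identity at \<open>y\<close>.\<close>

lemma transpose_cotranspose:
  assumes y: "y \<in> Obj B" and g: "g \<in> Hom A x (fobj G y)"
  shows "transpose x (cotranspose y g) = g"
proof -
  note x = A.Hom_obj(1)[OF g]
  note Ge = functor_arr[OF G counit_cmpt[OF y]] and Gy = functor_obj[OF G y]
  note Fg = functor_arr[OF F g]
  have "transpose x (cotranspose y g) =
      farr G (cmpt \<epsilon> y) \<cdot>\<^bsub>A\<^esub> (farr G (farr F g) \<cdot>\<^bsub>A\<^esub> cmpt \<eta> x)"
    unfolding transpose_def cotranspose_def
    using functor_cmp[OF G Fg counit_cmpt[OF y]] A.cmp_assoc[OF unit_cmpt[OF x] functor_arr[OF G Fg] Ge]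
    by simp
  also have "\<dots> = (farr G (cmpt \<epsilon> y) \<cdot>\<^bsub>A\<^esub> cmpt \<eta> (fobj G y)) \<cdot>\<^bsub>A\<^esub> g"
    using unit_natural[OF g] A.cmp_assoc[OF g unit_cmpt[OF Gy] Ge] by simp
  finally show ?thesis
    using triangle_G[OF y] A.ide_cmp[OF g] by simp
qed

text \<open>By the triangle identity at \<open>x\<close>, cotransposing undoes composition with the
  unit and leaves the bare action of \<open>F\<close>.\<close>

lemma cotranspose_unit_cmp:
  assumes g: "g \<in> Hom A w x"
  shows "cotranspose (fobj F x) (cmpt \<eta> x \<cdot>\<^bsub>A\<^esub> g) = farr F g"
proof -
  note x = A.Hom_obj(2)[OF g]
  note u = unit_cmpt[OF x]
  show ?thesis
    unfolding cotranspose_def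
    using functor_cmp[OF F g u] triangle_F[OF x] B.ide_cmp[OF functor_arr[OF F g]]
      B.cmp_assoc[OF functor_arr[OF F g] functor_arr[OF F u] counit_cmpt[OF functor_obj[OF F x]]] by simp
qed

text \<open>Cotransposing turns the equation after \<open>farr G m\<close> into one after
  \<open>m\<close>, which can be cancelled; transposing back recovers \<open>f = g\<close>.\<close>

lemma right_adjoint_mono:
  assumes "is_mono B m"
  shows "is_mono A (farr G m)"
proof (rule is_monoI)
  have m: "m \<in> Hom B (Dom B m) (Cod B m)" using assms by (simp add: is_mono_def Hom_iff)
  note y = B.Hom_obj(1)[OF m]
  show "farr G m \<in> Hom A (fobj G (Dom B m)) (fobj G (Cod B m))"
    using functor_arr[OF G m] .
  fix w f g assume f: "f \<in> Hom A w (fobj G (Dom B m))" and g: "g \<in> Hom A w (fobj G (Dom B m))"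
    and "farr G m \<cdot>\<^bsub>A\<^esub> f = farr G m \<cdot>\<^bsub>A\<^esub> g"
  then have "m \<cdot>\<^bsub>B\<^esub> cotranspose (Dom B m) f = m \<cdot>\<^bsub>B\<^esub> cotranspose (Dom B m) g"
    using cotranspose_cmp[OF f m] cotranspose_cmp[OF g m] by simp
  then have "cotranspose (Dom B m) f = cotranspose (Dom B m) g"
    using is_monoD[OF assms m] cotranspose_hom y f g by blast
  then show "f = g"
    using transpose_cotranspose[OF y f] transpose_cotranspose[OF y g] by metis
qed

section \<open>Adjointness for preradicals\<close>

text \<open>The two families of conditions do not correspond object by object: the condition at
  \<open>x\<close> is derived from the one at \<open>F x\<close>, and the condition at
  \<open>y\<close> from the one at \<open>G y\<close>. Naturality of \<open>\<tau>\<close> at the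
  unit and of \<open>\<sigma>\<close> at the counit brings the result back to the original
  object.\<close>

lemma pointwise_adjointness:
  assumes \<tau>: "is_nat_tr A A \<tau>" "trg \<tau> = id_functor A"
    and \<sigma>: "is_nat_tr B B \<sigma>" "trg \<sigma> = id_functor B"
  shows "(\<forall>y \<in> Obj B. factors_through B (cmpt \<epsilon> y \<cdot>\<^bsub>B\<^esub> farr F (cmpt \<tau> (fobj G y))) (cmpt \<sigma> y)) \<longleftrightarrow>
    (\<forall>x \<in> Obj A. factors_through A (cmpt \<eta> x \<cdot>\<^bsub>A\<^esub> cmpt \<tau> x) (farr G (cmpt \<sigma> (fobj F x))))"
proof
  note tH = preradical_cmpt[OF \<tau>] and sH = preradical_cmpt[OF \<sigma>]
  assume *: "\<forall>y \<in> Obj B. factors_through B (cmpt \<epsilon> y \<cdot>\<^bsub>B\<^esub> farr F (cmpt \<tau> (fobj G y))) (cmpt \<sigma> y)"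
  show "\<forall>x \<in> Obj A. factors_through A (cmpt \<eta> x \<cdot>\<^bsub>A\<^esub> cmpt \<tau> x) (farr G (cmpt \<sigma> (fobj F x)))"
  proof
    fix x assume x: "x \<in> Obj A"
    let ?y = "fobj F x" and ?x = "fobj G (fobj F x)"
    have y: "?y \<in> Obj B" and Gy: "?x \<in> Obj A"
      using functor_obj[OF F x] functor_obj[OF G functor_obj[OF F x]] by blast+
    note TGy = functor_obj[OF nat_tr_functor(1)[OF \<tau>(1)] Gy]
    have "cotranspose ?y (cmpt \<tau> ?x) \<in> Hom B (fobj F (fobj (src \<tau>) ?x)) ?y"
      using cotranspose_hom[OF y tH[OF Gy]] .
    then obtain u where u: "u \<in> Hom B (fobj F (fobj (src \<tau>) ?x)) (fobj (src \<sigma>) ?y)"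
      "cotranspose ?y (cmpt \<tau> ?x) = cmpt \<sigma> ?y \<cdot>\<^bsub>B\<^esub> u"
      using * y factors_through_iff[OF _ sH[OF y]] unfolding cotranspose_def by blast
    note u' = transpose_hom[OF TGy u(1)]
      and Te = functor_arr[OF nat_tr_functor(1)[OF \<tau>(1)] unit_cmpt[OF x]]
    \<comment> \<open>Transposing the equation for \<open>u\<close> shows that
      \<open>cmpt \<tau> ?x\<close> factors through the image of \<open>\<sigma>\<close> under
      \<open>G\<close>. But \<open>?x\<close> is \<open>G (F x)\<close>, so the first factor of
      \<open>?v\<close> transports the source from \<open>x\<close> to there along the unit.\<close>
    let ?v = "transpose (fobj (src \<tau>) ?x) u \<cdot>\<^bsub>A\<^esub> farr (src \<tau>) (cmpt \<eta> x)"
    have "farr G (cmpt \<sigma> ?y) \<cdot>\<^bsub>A\<^esub> ?v = transpose (fobj (src \<tau>) ?x) (cmpt \<sigma> ?y \<cdot>\<^bsub>B\<^esub> u) \<cdot>\<^bsub>A\<^esub> farr (src \<tau>) (cmpt \<eta> x)"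
      using transpose_cmp[OF TGy u(1) sH[OF y]] A.cmp_assoc[OF Te u' functor_arr[OF G sH[OF y]]] by simp
    also have "\<dots> = cmpt \<tau> ?x \<cdot>\<^bsub>A\<^esub> farr (src \<tau>) (cmpt \<eta> x)"
      using u(2) transpose_cotranspose[OF y tH[OF Gy]] by simp
    also have "\<dots> = cmpt \<eta> x \<cdot>\<^bsub>A\<^esub> cmpt \<tau> x"
      using preradical_natural[OF \<tau> unit_cmpt[OF x]] .
    finally show "factors_through A (cmpt \<eta> x \<cdot>\<^bsub>A\<^esub> cmpt \<tau> x) (farr G (cmpt \<sigma> ?y))"
      using A.cmp_hom[OF Te u'] A.cmp_hom[OF tH[OF x] unit_cmpt[OF x]] functor_arr[OF G sH[OF y]]
      by (intro factors_throughI[of ?v]) (auto simp: Hom_iff)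
  qed
next
  note tH = preradical_cmpt[OF \<tau>] and sH = preradical_cmpt[OF \<sigma>]
  assume *: "\<forall>x \<in> Obj A. factors_through A (cmpt \<eta> x \<cdot>\<^bsub>A\<^esub> cmpt \<tau> x) (farr G (cmpt \<sigma> (fobj F x)))"
  show "\<forall>y \<in> Obj B. factors_through B (cmpt \<epsilon> y \<cdot>\<^bsub>B\<^esub> farr F (cmpt \<tau> (fobj G y))) (cmpt \<sigma> y)"
  proof
    fix y assume y: "y \<in> Obj B"
    let ?x = "fobj G y" and ?y = "fobj F (fobj G y)"
    have x: "?x \<in> Obj A" and Fx: "?y \<in> Obj B"
      using functor_obj[OF G y] functor_obj[OF F functor_obj[OF G y]] by blast+
    note SFx = functor_obj[OF nat_tr_functor(1)[OF \<sigma>(1)] Fx]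
    obtain v where v: "v \<in> Hom A (fobj (src \<tau>) ?x) (fobj G (fobj (src \<sigma>) ?y))"
      "cmpt \<eta> ?x \<cdot>\<^bsub>A\<^esub> cmpt \<tau> ?x = farr G (cmpt \<sigma> ?y) \<cdot>\<^bsub>A\<^esub> v"
      using * x factors_through_iff[OF A.cmp_hom[OF tH[OF x] unit_cmpt[OF x]] functor_arr[OF G sH[OF Fx]]]
      by blast
    note v' = cotranspose_hom[OF SFx v(1)]
      and Se = functor_arr[OF nat_tr_functor(1)[OF \<sigma>(1)] counit_cmpt[OF y]]
    \<comment> \<open>Mirror image of the preceding witness: the cotranspose of \<open>v\<close>
      ends at the value of the source of \<open>\<sigma>\<close> at \<open>F (G y)\<close>, and the
      counit brings it down to \<open>y\<close>.\<close>
    let ?u = "farr (src \<sigma>) (cmpt \<epsilon> y) \<cdot>\<^bsub>B\<^esub> cotranspose (fobj (src \<sigma>) ?y) v"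
    have "cmpt \<sigma> y \<cdot>\<^bsub>B\<^esub> ?u = cmpt \<epsilon> y \<cdot>\<^bsub>B\<^esub> (cmpt \<sigma> ?y \<cdot>\<^bsub>B\<^esub> cotranspose (fobj (src \<sigma>) ?y) v)"
      using preradical_natural[OF \<sigma> counit_cmpt[OF y]] B.cmp_assoc[OF v' Se sH[OF y]]
        B.cmp_assoc[OF v' sH[OF Fx] counit_cmpt[OF y]] by simp
    also have "\<dots> = cmpt \<epsilon> y \<cdot>\<^bsub>B\<^esub> farr F (cmpt \<tau> ?x)"
      using cotranspose_cmp[OF v(1) sH[OF Fx]] v(2) cotranspose_unit_cmp[OF tH[OF x]] by simp
    finally show "factors_through B (cmpt \<epsilon> y \<cdot>\<^bsub>B\<^esub> farr F (cmpt \<tau> ?x)) (cmpt \<sigma> y)"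
      using B.cmp_hom[OF v' Se] B.cmp_hom[OF functor_arr[OF F tH[OF x]] counit_cmpt[OF y]] sH[OF y]
      by (intro factors_throughI[of ?u]) (auto simp: Hom_iff)
  qed
qed

lemma lower_arr:
  assumes \<tau>: "is_nat_tr A A \<tau>" "trg \<tau> = id_functor A"
  shows "is_nat_tr B B (\<epsilon> \<cdot>\<^bsub>Fun B B\<^esub> whisker B F \<tau> G)"
proof (rule BB.nat_tr_cmp)
  show "is_nat_tr B B (whisker B F \<tau> G)"
    using whisker_nat_tr[OF B.category_axioms G \<tau>(1) F] .
  show "trg (whisker B F \<tau> G) = src \<epsilon>"
    using comp_id_functor[OF G] \<tau>(2) by (simp add: whisker_def counit)
qed (rule counit)

text \<open>Components of \<open>\<sigma>\<close> are mono by \<open>Fun_mono_cmpt\<close>, and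
  \<open>G\<close> preserves this. So the whiskered arrow qualifies for
  \<open>pullback_of_iff\<close> and its pullback along the unit is a preradical.\<close>

lemma upper_arr:
  assumes \<sigma>: "is_mono (Fun B B) \<sigma>" "trg \<sigma> = id_functor B"
  shows "is_mono (Fun A A) (whisker A G \<sigma> F)" "trg (whisker A G \<sigma> F) = trg \<eta>"
proof -
  have "is_nat_tr B B \<sigma>" using \<sigma>(1) by (simp add: is_mono_def)
  then show "is_mono (Fun A A) (whisker A G \<sigma> F)"
    using right_adjoint_mono[OF BB.Fun_mono_cmpt[OF \<sigma>(1) functor_obj[OF F]]]
      whisker_nat_tr[OF A.category_axioms F _ G]
    by (intro AA.Fun_monoI) (auto simp: whisker_def)
  show "trg (whisker A G \<sigma> F) = trg \<eta>"
    using comp_id_functor[OF F] \<sigma>(2) by (simp add: whisker_def unit)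
qed

text \<open>Both arrows to factor through are monomorphisms of functor categories, so each
  factorization reduces to its components, where \<open>pointwise_adjointness\<close>
  applies.\<close>

lemma adjointness:
  assumes \<tau>: "is_nat_tr A A \<tau>" "trg \<tau> = id_functor A"
    and \<sigma>: "is_mono (Fun B B) \<sigma>" "trg \<sigma> = id_functor B"
  shows "factors_through (Fun B B) (\<epsilon> \<cdot>\<^bsub>Fun B B\<^esub> whisker B F \<tau> G) \<sigma> \<longleftrightarrow>
    factors_through (Fun A A) (\<eta> \<cdot>\<^bsub>Fun A A\<^esub> \<tau>) (whisker A G \<sigma> F)"
proof -
  have s: "is_nat_tr B B \<sigma>" using \<sigma>(1) by (simp add: is_mono_def)
  have et: "is_nat_tr A A (\<eta> \<cdot>\<^bsub>Fun A A\<^esub> \<tau>)"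
    using AA.nat_tr_cmp[OF \<tau>(1) unit(1)] \<tau>(2) unit(2) by simp
  show ?thesis
    using BB.Fun_factors_through_iff[OF \<sigma>(1) lower_arr[OF \<tau>]] AA.Fun_factors_through_iff[OF upper_arr(1)[OF \<sigma>] et]
      upper_arr(2)[OF \<sigma>] counit(3) \<sigma>(2) pointwise_adjointness[OF \<tau> s \<sigma>(2)]
    by (simp add: whisker_def)
qed

section \<open>The induced maps on preradicals\<close>

text \<open>By \<open>adjointness\<close>, the monomorphisms through which the arrow built from
  \<open>\<tau>\<close> factors are governed by \<open>\<eta> \<cdot> \<tau>\<close>. On that side
  replacing \<open>\<tau>\<close> by an equivalent representative is mere composition with
  \<open>\<eta>\<close>, so it is never necessary to whisker a factorization.\<close>

lemma induced_lower_eq: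
  assumes P: "P \<in> carrier (Pr A)" and \<tau>: "\<tau> \<in> P"
  shows "induced_lower B F G \<epsilon> P = image_of (Fun B B) (\<epsilon> \<cdot>\<^bsub>Fun B B\<^esub> whisker B F \<tau> G)"
proof -
  note Pr = Pr_elem[OF P _ AA.Fun.category_axioms]
  have ft: "factors_through (Fun A A) (\<eta> \<cdot>\<^bsub>Fun A A\<^esub> \<tau>') n"
    if "factors_through (Fun A A) (\<eta> \<cdot>\<^bsub>Fun A A\<^esub> \<tau>'') n" "\<tau>' \<in> P" "\<tau>'' \<in> P" "is_mono (Fun A A) n" for \<tau>' \<tau>'' n
  proof -
    have "factors_through (Fun A A) \<tau>' \<tau>''"
      using AA.Fun.Sub_elem_factors[OF P[unfolded Pr_def]] that by blast
    then have "factors_through (Fun A A) (\<eta> \<cdot>\<^bsub>Fun A A\<^esub> \<tau>') (\<eta> \<cdot>\<^bsub>Fun A A\<^esub> \<tau>'')"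
      using Pr[OF that(2)] Pr[OF that(3)] unit
      by (intro AA.Fun.factors_through_cmp[where a = "src \<tau>'" and b = "src \<tau>''"]) (auto simp: Fun_Hom)
    then show ?thesis
      using that AA.Fun.factors_through_mono_trans by blast
  qed
  have "image_of (Fun B B) (\<epsilon> \<cdot>\<^bsub>Fun B B\<^esub> whisker B F \<tau>' G) = image_of (Fun B B) (\<epsilon> \<cdot>\<^bsub>Fun B B\<^esub> whisker B F \<tau> G)"
    if \<tau>': "\<tau>' \<in> P" for \<tau>'
  proof (rule BB.Fun.image_of_cong)
    fix n assume n: "is_mono (Fun B B) n" "Cod (Fun B B) n = Cod (Fun B B) (\<epsilon> \<cdot>\<^bsub>Fun B B\<^esub> whisker B F \<tau>' G)"
    then have n': "trg n = id_functor B" by (simp add: counit)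
    show "factors_through (Fun B B) (\<epsilon> \<cdot>\<^bsub>Fun B B\<^esub> whisker B F \<tau>' G) n =
      factors_through (Fun B B) (\<epsilon> \<cdot>\<^bsub>Fun B B\<^esub> whisker B F \<tau> G) n"
      unfolding adjointness[OF Pr(2,3)[OF \<tau>'] n(1) n'] adjointness[OF Pr(2,3)[OF \<tau>] n(1) n']
      using ft[OF _ \<tau>' \<tau> upper_arr(1)[OF n(1) n']] ft[OF _ \<tau> \<tau>' upper_arr(1)[OF n(1) n']] by (rule iffI[rotated])
  qed (use lower_arr Pr \<tau> \<tau>' in auto)
  then have "induced_lower B F G \<epsilon> P = (\<Union>\<tau>' \<in> P. image_of (Fun B B) (\<epsilon> \<cdot>\<^bsub>Fun B B\<^esub> whisker B F \<tau> G))"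
    unfolding induced_lower_def by (rule SUP_cong[OF refl])
  then show ?thesis
    using \<tau> UN_constant[of _ P] by (metis empty_iff)
qed

text \<open>Here \<open>adjointness\<close> is read backwards: whether
  \<open>\<eta> \<cdot> h\<close> factors through the whiskered \<open>\<sigma>\<close> depends on
  what factors through \<open>\<sigma>\<close> itself, and that is the same for equivalent
  representatives.\<close>

lemma induced_upper_eq:
  assumes Q: "Q \<in> carrier (Pr B)" and \<sigma>: "\<sigma> \<in> Q"
  shows "induced_upper A F G \<eta> Q = pullback_of (Fun A A) \<eta> (whisker A G \<sigma> F)"
proof -
  note Pr = Pr_elem[OF Q _ BB.Fun.category_axioms]
  have ft: "factors_through (Fun B B) h \<sigma>'"
    if "factors_through (Fun B B) h \<sigma>''" "\<sigma>' \<in> Q" "\<sigma>'' \<in> Q" for \<sigma>' \<sigma>'' h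
    using BB.Fun.Sub_elem_factors[OF Q[unfolded Pr_def] that(3,2)]
      BB.Fun.factors_through_mono_trans[OF that(1) _ Pr(1)[OF that(2)]] by blast
  have "pullback_of (Fun A A) \<eta> (whisker A G \<sigma>' F) = pullback_of (Fun A A) \<eta> (whisker A G \<sigma> F)"
    if \<sigma>': "\<sigma>' \<in> Q" for \<sigma>'
  proof (rule AA.Fun.pullback_of_cong)
    fix h assume h: "h \<in> Arr (Fun A A)" "Cod (Fun A A) h = Dom (Fun A A) \<eta>"
    then have h': "is_nat_tr A A h" "trg h = id_functor A" by (simp_all add: unit)
    show "factors_through (Fun A A) (\<eta> \<cdot>\<^bsub>Fun A A\<^esub> h) (whisker A G \<sigma>' F) =
      factors_through (Fun A A) (\<eta> \<cdot>\<^bsub>Fun A A\<^esub> h) (whisker A G \<sigma> F)"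
      unfolding adjointness[OF h' Pr(1,3)[OF \<sigma>'], symmetric] adjointness[OF h' Pr(1,3)[OF \<sigma>], symmetric]
      using ft[OF _ \<sigma>' \<sigma>] ft[OF _ \<sigma> \<sigma>'] by (rule iffI[rotated])
  qed (use upper_arr Pr \<sigma> \<sigma>' unit in auto)
  then have "induced_upper A F G \<eta> Q = (\<Union>\<sigma>' \<in> Q. pullback_of (Fun A A) \<eta> (whisker A G \<sigma> F))"
    unfolding induced_upper_def by (rule SUP_cong[OF refl])
  then show ?thesis
    using \<sigma> UN_constant[of _ Q] by (metis empty_iff)
qed

lemma induced_lower_Pr:
  assumes P: "P \<in> carrier (Pr A)"
  shows "induced_lower B F G \<epsilon> P \<in> carrier (Pr B)"
proof -
  obtain \<tau> where \<tau>: "\<tau> \<in> P"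
    using AA.Fun.Sub_elem_nonempty P[unfolded Pr_def] by blast
  have "is_nat_tr B B (\<epsilon> \<cdot>\<^bsub>Fun B B\<^esub> whisker B F \<tau> G)"
    using lower_arr Pr_elem[OF P \<tau> AA.Fun.category_axioms] by blast
  then show ?thesis
    using BB.Fun.image_of_Sub[of "\<epsilon> \<cdot>\<^bsub>Fun B B\<^esub> whisker B F \<tau> G"]
    by (simp add: induced_lower_eq[OF P \<tau>] Pr_def counit)
qed

lemma induced_upper_Pr:
  assumes Q: "Q \<in> carrier (Pr B)"
  shows "induced_upper A F G \<eta> Q \<in> carrier (Pr A)"
proof -
  obtain \<sigma> where \<sigma>: "\<sigma> \<in> Q"
    using BB.Fun.Sub_elem_nonempty Q[unfolded Pr_def] by blast
  note u = upper_arr[OF Pr_elem(1,3)[OF Q \<sigma> BB.Fun.category_axioms]]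
  show ?thesis
    using AA.Fun.pullback_of_Sub[of \<eta>, OF _ u(1)] u(2) unit(1,2)
    by (simp add: induced_upper_eq[OF Q \<sigma>] Pr_def)
qed

lemma induced_galois:
  assumes P: "P \<in> carrier (Pr A)" and Q: "Q \<in> carrier (Pr B)"
  shows "le (Pr B) (induced_lower B F G \<epsilon> P) Q \<longleftrightarrow> le (Pr A) P (induced_upper A F G \<eta> Q)"
proof -
  obtain \<tau> where \<tau>: "\<tau> \<in> P"
    using AA.Fun.Sub_elem_nonempty P[unfolded Pr_def] by blast
  obtain \<sigma> where \<sigma>: "\<sigma> \<in> Q"
    using BB.Fun.Sub_elem_nonempty Q[unfolded Pr_def] by blast
  note t = Pr_elem[OF P \<tau> AA.Fun.category_axioms]
  note s = Pr_elem[OF Q \<sigma> BB.Fun.category_axioms]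
  note u = upper_arr[OF s(1,3)]
  have eta: "\<eta> \<in> Arr (Fun A A)" "Cod (Fun A A) (whisker A G \<sigma> F) = Cod (Fun A A) \<eta>"
    using unit u by auto
  obtain m where m: "m \<in> induced_lower B F G \<epsilon> P"
    using BB.Fun.Sub_elem_nonempty induced_lower_Pr[OF P, unfolded Pr_def] by blast
  obtain p where p: "p \<in> induced_upper A F G \<eta> Q"
    using AA.Fun.Sub_elem_nonempty induced_upper_Pr[OF Q, unfolded Pr_def] by blast
  \<comment> \<open>With representatives fixed on both sides, the order on classes becomes
    factorization, to which the properties of image and pullback apply.\<close>
  have "le (Pr B) (induced_lower B F G \<epsilon> P) Q \<longleftrightarrow> factors_through (Fun B B) m \<sigma>"
    unfolding Pr_def
    using BB.Fun.Sub_le_iff[OF induced_lower_Pr[OF P, unfolded Pr_def] m Q[unfolded Pr_def] \<sigma>] .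
  also have "\<dots> \<longleftrightarrow> factors_through (Fun B B) (\<epsilon> \<cdot>\<^bsub>Fun B B\<^esub> whisker B F \<tau> G) \<sigma>"
    using BB.Fun.image_of_factors[OF m[unfolded induced_lower_eq[OF P \<tau>]] s(1)] s(3) by (simp add: counit)
  also have "\<dots> \<longleftrightarrow> factors_through (Fun A A) (\<eta> \<cdot>\<^bsub>Fun A A\<^esub> \<tau>) (whisker A G \<sigma> F)"
    using adjointness[OF t(2,3) s(1,3)] .
  also have "\<dots> \<longleftrightarrow> factors_through (Fun A A) \<tau> p"
    using p[unfolded induced_upper_eq[OF Q \<sigma>] AA.Fun.pullback_of_iff[OF eta(1) u(1) eta(2)]] t(2,3)
    by (simp add: unit)
  also have "\<dots> \<longleftrightarrow> le (Pr A) P (induced_upper A F G \<eta> Q)"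
    unfolding Pr_def
    using AA.Fun.Sub_le_iff[OF P[unfolded Pr_def] \<tau> induced_upper_Pr[OF Q, unfolded Pr_def] p] by simp
  finally show ?thesis .
qed

end

theorem theorem4p2:
  fixes A :: "('a, 'm) category" and B :: "('b, 'n) category"
    and F :: "('a, 'm, 'b, 'n) fnctr" and G :: "('b, 'n, 'a, 'm) fnctr"
    and \<eta> :: "('a, 'm, 'a, 'm) nat_tr" and \<epsilon> :: "('b, 'n, 'b, 'n) nat_tr"
  assumes "abelian_category A" and "abelian_category B"
    and "adjoint_pair A B F G \<eta> \<epsilon>"
  shows "galois_connection
           \<lparr>orderA = Pr A, orderB = Pr B,
            lower = induced_lower B F G \<epsilon>, upper = induced_upper A F G \<eta>\<rparr>"
proof -
  interpret adjunction A B F G \<eta> \<epsilon>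
    using assms by (simp add: adjunction_def adjunction_axioms_def)
  show ?thesis
    \<comment> \<open>The goal splits into the two partial orders, the fact that each map sends
      preradicals to preradicals, and the equivalence of \<open>induced_galois\<close>.\<close>
    unfolding galois_connection_def galois_connection_axioms_def connection_def
    using induced_lower_Pr induced_upper_Pr induced_galois
      AA.Fun.Sub_partial_order[of "id_functor A"] BB.Fun.Sub_partial_order[of "id_functor B"]
    by (simp add: Pr_def)
qed

end
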